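(* Let $\delta$ be a measurable cardinal and let $\nu>\delta$ be a $\delta$-inaccessible cardinal with $\mathrm{cof}(\nu)\neq\delta$. If $\kappa$ is a cardinal with $\nu\leq\kappa\leq\nu^+$, then there is no good $\Sigma_1(\kappa)$-wellordering of $\mathcal{P}(\kappa)$.
   Context: We work in ZFC. For cardinals $\delta<\nu$, $\nu$ is $\delta$-inaccessible if $\lambda^\delta<\nu$ holds for all $\lambda<\nu$. For sets $y_0,\ldots,y_{n-1}$, a set $X$ is $\Sigma_1(y_0,\ldots,y_{n-1})$-definable if there is a $\Sigma_1$-formula $\varphi(v_0,\ldots,v_n)$ (in the Lévy hierarchy, in the language of set theory) with $X=\{x\mid\varphi(x,y_0,\ldots,y_{n-1})\}$. A wellordering $\lhd$ of a set $X$ is a good $\Sigma_1(y_0,\ldots,y_{n-1})$-wellordering of $X$ if the set $I(\lhd)=\{\{x\in X\mid x\lhd y\}\mid y\in X\}$ of all proper initial segments of $\lhd$ is $\Sigma_1(y_0,\ldots,y_{n-1})$-definable. *)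

theory Defs
  imports Main
begin

text \<open>
  A first-order structure for the language of set theory is a type together with a binary
  relation on it.  Working in ZFC is rendered as working in an arbitrary structure satisfying the
  first-order axioms of ZFC, Separation and Replacement being schemas over deeply embedded
  formulas.  All notions of set theory below quantify over elements of the structure only, so they
  are interpretations of first-order formulas in it; HOL sets of elements play the role of
  classes.
\<close>

section \<open>Formulas and the Levy hierarchy\<close>

text \<open>Formulas have named variables; the variable \<open>v\<^sub>i\<close> is the number \<open>i\<close>.\<close>

datatype fm =
    FMem nat nat
  | FEq nat nat
  | FNot fm
  | FAnd fm fm
  | FEx nat fm

primrec fv :: "fm \<Rightarrow> nat set" where
  "fv (FMem i j) = {i, j}"
| "fv (FEq i j) = {i, j}"
| "fv (FNot \<phi>) = fv \<phi>"
| "fv (FAnd \<phi> \<psi>) = fv \<phi> \<union> fv \<psi>"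
| "fv (FEx i \<phi>) = fv \<phi> - {i}"

text \<open>
  The last rule is the bounded quantifier \<open>\<exists>v\<^sub>i \<in> v\<^sub>j. \<phi>\<close>; bounded universal quantifiers, like all
  universal quantifiers, are obtained from it by negation.
\<close>

inductive Delta0 :: "fm \<Rightarrow> bool" where
  "Delta0 (FMem i j)"
| "Delta0 (FEq i j)"
| "Delta0 \<phi> \<Longrightarrow> Delta0 (FNot \<phi>)"
| "Delta0 \<phi> \<Longrightarrow> Delta0 \<psi> \<Longrightarrow> Delta0 (FAnd \<phi> \<psi>)"
| "i \<noteq> j \<Longrightarrow> Delta0 \<phi> \<Longrightarrow> Delta0 (FEx i (FAnd (FMem i j) \<phi>))"

inductive Sigma1 :: "fm \<Rightarrow> bool" where
  "Delta0 \<phi> \<Longrightarrow> Sigma1 \<phi>"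
| "Sigma1 \<phi> \<Longrightarrow> Sigma1 (FEx i \<phi>)"

section \<open>Notions of set theory in a structure\<close>

locale set_structure =
  fixes mem :: "'v \<Rightarrow> 'v \<Rightarrow> bool"  (infix "\<^bold>\<in>" 50)
begin

primrec sat :: "(nat \<Rightarrow> 'v) \<Rightarrow> fm \<Rightarrow> bool" where
  "sat e (FMem i j) \<longleftrightarrow> e i \<^bold>\<in> e j"
| "sat e (FEq i j) \<longleftrightarrow> e i = e j"
| "sat e (FNot \<phi>) \<longleftrightarrow> \<not> sat e \<phi>"
| "sat e (FAnd \<phi> \<psi>) \<longleftrightarrow> sat e \<phi> \<and> sat e \<psi>"
| "sat e (FEx i \<phi>) \<longleftrightarrow> (\<exists>x. sat (e(i := x)) \<phi>)"

definition ext :: "'v \<Rightarrow> 'v set" where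
  "ext x = {z. z \<^bold>\<in> x}"

text \<open>
  Definability over the structure.  The set or class \<open>X\<close> is given by its elements.  The variable
  \<open>v\<^sub>0\<close> is interpreted by \<open>x\<close> and \<open>v\<^sub>1, \<dots>, v\<^sub>n\<close> by the parameters; the condition on the free variables
  makes the values of the assignment beyond \<open>n\<close> irrelevant.
\<close>

definition Sigma1_definable :: "'v list \<Rightarrow> 'v set \<Rightarrow> bool" where
  "Sigma1_definable ys X \<longleftrightarrow>
    (\<exists>\<phi>. Sigma1 \<phi> \<and> fv \<phi> \<subseteq> {..length ys} \<and> X = {x. sat (\<lambda>i. (x # ys) ! i) \<phi>})"

definition is_powerset :: "'v \<Rightarrow> 'v \<Rightarrow> bool" where
  "is_powerset P x \<longleftrightarrow> ext P = {s. ext s \<subseteq> ext x}"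

definition is_pair :: "'v \<Rightarrow> 'v \<Rightarrow> 'v \<Rightarrow> bool" where
  "is_pair p x y \<longleftrightarrow> (\<exists>a b. ext a = {x} \<and> ext b = {x, y} \<and> ext p = {a, b})"

definition rel :: "'v \<Rightarrow> 'v \<Rightarrow> 'v \<Rightarrow> bool" where
  "rel r x y \<longleftrightarrow> (\<exists>p. p \<^bold>\<in> r \<and> is_pair p x y)"

definition relation_on :: "'v \<Rightarrow> 'v \<Rightarrow> 'v \<Rightarrow> bool" where
  "relation_on r a b \<longleftrightarrow> (\<forall>p\<in>ext r. \<exists>x\<in>ext a. \<exists>y\<in>ext b. is_pair p x y)"

definition is_fun :: "'v \<Rightarrow> 'v \<Rightarrow> 'v \<Rightarrow> bool" where
  "is_fun f a b \<longleftrightarrow> relation_on f a b \<and> (\<forall>x\<in>ext a. \<exists>!y. rel f x y)"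

definition is_bij :: "'v \<Rightarrow> 'v \<Rightarrow> 'v \<Rightarrow> bool" where
  "is_bij f a b \<longleftrightarrow> is_fun f a b \<and> (\<forall>y\<in>ext b. \<exists>!x. rel f x y)"

definition equipotent :: "'v \<Rightarrow> 'v \<Rightarrow> bool" where
  "equipotent a b \<longleftrightarrow> (\<exists>f. is_bij f a b)"

text \<open>Strict wellorderings; only nonempty subsets that are elements of the structure count.\<close>

definition strictly_wellorders :: "('v \<Rightarrow> 'v \<Rightarrow> bool) \<Rightarrow> 'v \<Rightarrow> bool" where
  "strictly_wellorders R X \<longleftrightarrow>
    (\<forall>x\<in>ext X. \<not> R x x) \<and>
    (\<forall>x\<in>ext X. \<forall>y\<in>ext X. \<forall>z\<in>ext X. R x y \<longrightarrow> R y z \<longrightarrow> R x z) \<and>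
    (\<forall>x\<in>ext X. \<forall>y\<in>ext X. R x y \<or> x = y \<or> R y x) \<and>
    (\<forall>s. ext s \<subseteq> ext X \<longrightarrow> ext s \<noteq> {} \<longrightarrow> (\<exists>m\<in>ext s. \<forall>x\<in>ext s. x = m \<or> R m x))"

definition wellordering :: "'v \<Rightarrow> 'v \<Rightarrow> bool" where
  "wellordering w X \<longleftrightarrow> relation_on w X X \<and> strictly_wellorders (rel w) X"

definition initial_segments :: "'v \<Rightarrow> 'v \<Rightarrow> 'v set" where
  "initial_segments w X = {s. \<exists>y\<in>ext X. ext s = {x \<in> ext X. rel w x y}}"

definition good_Sigma1_wellordering :: "'v list \<Rightarrow> 'v \<Rightarrow> 'v \<Rightarrow> bool" where
  "good_Sigma1_wellordering ys w X \<longleftrightarrow>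
    wellordering w X \<and> Sigma1_definable ys (initial_segments w X)"

subsection \<open>Ordinals and cardinals\<close>

definition ordinal :: "'v \<Rightarrow> bool" where
  "ordinal \<alpha> \<longleftrightarrow> (\<forall>\<beta>\<in>ext \<alpha>. ext \<beta> \<subseteq> ext \<alpha>) \<and> strictly_wellorders (\<^bold>\<in>) \<alpha>"

definition ord_le :: "'v \<Rightarrow> 'v \<Rightarrow> bool" where
  "ord_le \<alpha> \<beta> \<longleftrightarrow> \<alpha> \<^bold>\<in> \<beta> \<or> \<alpha> = \<beta>"

definition limit_ordinal :: "'v \<Rightarrow> bool" where
  "limit_ordinal \<alpha> \<longleftrightarrow>
    ordinal \<alpha> \<and> ext \<alpha> \<noteq> {} \<and> (\<forall>\<beta>\<in>ext \<alpha>. \<exists>\<gamma>\<in>ext \<alpha>. \<beta> \<^bold>\<in> \<gamma>)"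

definition is_omega :: "'v \<Rightarrow> bool" where
  "is_omega w \<longleftrightarrow> limit_ordinal w \<and> (\<forall>\<beta>\<in>ext w. \<not> limit_ordinal \<beta>)"

definition cardinal :: "'v \<Rightarrow> bool" where
  "cardinal \<kappa> \<longleftrightarrow> ordinal \<kappa> \<and> (\<forall>\<alpha>\<in>ext \<kappa>. \<not> equipotent \<alpha> \<kappa>)"

definition is_successor_cardinal :: "'v \<Rightarrow> 'v \<Rightarrow> bool" where
  "is_successor_cardinal \<mu> \<nu> \<longleftrightarrow>
    cardinal \<mu> \<and> \<nu> \<^bold>\<in> \<mu> \<and> (\<forall>\<rho>. cardinal \<rho> \<longrightarrow> \<nu> \<^bold>\<in> \<rho> \<longrightarrow> ord_le \<mu> \<rho>)"

text \<open>\<open>\<mu> = \<lambda>\<^sup>\<delta>\<close>, the cardinality of the set of all functions from \<open>\<delta>\<close> to \<open>\<lambda>\<close>.\<close>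

definition is_cardinal_power :: "'v \<Rightarrow> 'v \<Rightarrow> 'v \<Rightarrow> bool" where
  "is_cardinal_power \<mu> l \<delta> \<longleftrightarrow>
    cardinal \<mu> \<and> (\<exists>F. ext F = {f. is_fun f \<delta> l} \<and> equipotent F \<mu>)"

definition inaccessible_for :: "'v \<Rightarrow> 'v \<Rightarrow> bool" where
  "inaccessible_for \<delta> \<nu> \<longleftrightarrow> cardinal \<delta> \<and> cardinal \<nu> \<and> \<delta> \<^bold>\<in> \<nu> \<and>
    (\<forall>l. cardinal l \<longrightarrow> l \<^bold>\<in> \<nu> \<longrightarrow> (\<exists>\<mu>. is_cardinal_power \<mu> l \<delta> \<and> \<mu> \<^bold>\<in> \<nu>))"

definition cofinal_map :: "'v \<Rightarrow> 'v \<Rightarrow> 'v \<Rightarrow> bool" where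
  "cofinal_map f \<gamma> \<nu> \<longleftrightarrow> is_fun f \<gamma> \<nu> \<and>
    (\<forall>\<alpha>\<in>ext \<nu>. \<exists>\<xi>\<in>ext \<gamma>. \<exists>\<beta>. rel f \<xi> \<beta> \<and> ord_le \<alpha> \<beta>)"

definition is_cof :: "'v \<Rightarrow> 'v \<Rightarrow> bool" where
  "is_cof \<gamma> \<nu> \<longleftrightarrow>
    ordinal \<gamma> \<and> (\<exists>f. cofinal_map f \<gamma> \<nu>) \<and> (\<forall>\<beta>\<in>ext \<gamma>. \<not> (\<exists>f. cofinal_map f \<beta> \<nu>))"

subsection \<open>Measurable cardinals\<close>

definition ultrafilter_on :: "'v \<Rightarrow> 'v \<Rightarrow> bool" where
  "ultrafilter_on U S \<longleftrightarrow>
    (\<forall>s\<in>ext U. ext s \<subseteq> ext S \<and> ext s \<noteq> {}) \<and>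
    S \<^bold>\<in> U \<and>
    (\<forall>s\<in>ext U. \<forall>t. ext s \<subseteq> ext t \<longrightarrow> ext t \<subseteq> ext S \<longrightarrow> t \<^bold>\<in> U) \<and>
    (\<forall>s\<in>ext U. \<forall>t\<in>ext U. \<exists>u\<in>ext U. ext u = ext s \<inter> ext t) \<and>
    (\<forall>s. ext s \<subseteq> ext S \<longrightarrow> s \<^bold>\<in> U \<or> (\<exists>t\<in>ext U. ext t = ext S - ext s))"

definition nonprincipal :: "'v \<Rightarrow> 'v \<Rightarrow> bool" where
  "nonprincipal U S \<longleftrightarrow> \<not> (\<exists>a. ext U = {s. ext a \<subseteq> ext s \<and> ext s \<subseteq> ext S})"

text \<open>Closure under intersections of sequences \<open>f : \<gamma> \<rightarrow> U\<close> of length \<open>\<gamma> < \<delta>\<close>.\<close>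

definition complete_filter :: "'v \<Rightarrow> 'v \<Rightarrow> 'v \<Rightarrow> bool" where
  "complete_filter \<delta> U S \<longleftrightarrow>
    (\<forall>\<gamma>\<in>ext \<delta>. \<forall>f. is_fun f \<gamma> U \<longrightarrow>
      (\<exists>t\<in>ext U. ext t = {x \<in> ext S. \<forall>\<xi> s. rel f \<xi> s \<longrightarrow> x \<^bold>\<in> s}))"

definition measurable_cardinal :: "'v \<Rightarrow> bool" where
  "measurable_cardinal \<delta> \<longleftrightarrow>
    cardinal \<delta> \<and> (\<exists>w. is_omega w \<and> w \<^bold>\<in> \<delta>) \<and>
    (\<exists>U. ultrafilter_on U \<delta> \<and> nonprincipal U \<delta> \<and> complete_filter \<delta> U \<delta>)"

end

section \<open>The axioms of ZFC\<close>

locale ZFC_structure = set_structure mem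
  for mem :: "'v \<Rightarrow> 'v \<Rightarrow> bool"  (infix "\<^bold>\<in>" 50) +
  assumes Extensionality: "ext x = ext y \<Longrightarrow> x = y"
    and Foundation: "ext x \<noteq> {} \<Longrightarrow> \<exists>y\<in>ext x. ext y \<inter> ext x = {}"
    and Pairing: "\<exists>z. ext z = {x, y}"
    and Union: "\<exists>z. ext z = (\<Union>y\<in>ext x. ext y)"
    and Powerset: "\<exists>z. is_powerset z x"
    and Infinity: "\<exists>w. (\<exists>z\<in>ext w. ext z = {}) \<and>
      (\<forall>x\<in>ext w. \<exists>y\<in>ext w. ext y = insert x (ext x))"
    and Separation: "\<exists>z. ext z = {y \<in> ext x. sat (e(i := y)) \<phi>}"
    and Replacement: "i \<noteq> j \<Longrightarrow> (\<And>x. x \<^bold>\<in> a \<Longrightarrow> \<exists>!y. sat (e(i := x, j := y)) \<phi>) \<Longrightarrow>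
      \<exists>b. ext b = {y. \<exists>x\<in>ext a. sat (e(i := x, j := y)) \<phi>}"
    and Choice: "(\<And>y. y \<^bold>\<in> x \<Longrightarrow> ext y \<noteq> {}) \<Longrightarrow>
      (\<And>y z. y \<^bold>\<in> x \<Longrightarrow> z \<^bold>\<in> x \<Longrightarrow> y \<noteq> z \<Longrightarrow> ext y \<inter> ext z = {}) \<Longrightarrow>
      \<exists>c. \<forall>y\<in>ext x. \<exists>!z. z \<^bold>\<in> c \<and> z \<^bold>\<in> y"

end

theory Submission
  imports Defs
begin

text \<open>
  Fix a measure on \<open>\<delta>\<close> and let \<open>j\<close> be its ultrapower embedding.  The hypotheses on \<open>\<nu>\<close> give
  \<open>j \<nu> = \<nu>\<close> and hence \<open>j \<kappa> = \<kappa>\<close>.  If the initial segments of a wellordering \<open>\<lhd>\<close> of \<open>\<P>(\<kappa>)\<close> are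
  \<open>\<Sigma>\<^sub>1(\<kappa>)\<close>-definable, then upwards absoluteness of \<open>\<Sigma>\<^sub>1\<close>-formulas from the ultrapower to the universe
  shows that \<open>j\<close> maps the segment below \<open>x\<close> to the segment below some \<open>h x\<close>.  The map \<open>h\<close> is order
  preserving, so \<open>h x\<close> is never below \<open>x\<close>, and everything below \<open>h x\<close> lies in the ultrapower.
  Hence a subset of \<open>\<kappa>\<close> outside the ultrapower is not below anything, and there is at most one.
  But neither the pointwise image of \<open>\<kappa>\<close> under \<open>j\<close> nor its complement in \<open>\<kappa>\<close> lies in the ultrapower.

  Only absoluteness of \<open>\<Delta>\<^sub>0\<close>-formulas is needed, so it suffices to collapse the ultrapowers of
  transitive sets \<open>T\<close>.
\<close>

section \<open>Definability with parameters\<close>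

text \<open>The model is arbitrary and need not be wellfounded from outside, and Separation and
  Replacement apply to formulas only. Hence inductions, recursions and set formations on elements
  run inside the model and owe a definability proof; \<open>dfn\<close> and \<open>tm\<close> let
  these be discharged by decomposing the syntax of HOL terms.

  Why \<nu> is fixed: for \<alpha> < \<nu> there are fewer than \<nu> functions from \<delta> to
  \<alpha>, so j \<alpha> < \<nu>. Moreover every function from \<delta> to \<nu> is bounded on a
  measure one set: by completeness if cof(\<nu>) < \<delta>, and everywhere if cof(\<nu>) >
  \<delta>. For \<kappa> above \<nu>, every ordinal below \<kappa> injects into \<nu>, and
  representing functions carry this over to elements of j \<kappa> and j \<nu> = \<nu>.

  The two sets compared at the end are complementary because one argument then serves both: a
  function representing the complement can be complemented at each coordinate.\<close>

primrec ren :: "(nat \<Rightarrow> nat) \<Rightarrow> fm \<Rightarrow> fm" where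
  "ren r (FMem i j) = FMem (r i) (r j)"
| "ren r (FEq i j) = FEq (r i) (r j)"
| "ren r (FNot \<phi>) = FNot (ren r \<phi>)"
| "ren r (FAnd \<phi> \<psi>) = FAnd (ren r \<phi>) (ren r \<psi>)"
| "ren r (FEx i \<phi>) = FEx (r i) (ren r \<phi>)"

definition mrg :: "(nat \<Rightarrow> 'a) \<Rightarrow> (nat \<Rightarrow> 'a) \<Rightarrow> nat \<Rightarrow> 'a" where
  "mrg e c n = (if even n then e (n div 2) else c (n div 2))"

lemma mrg_simps [simp]: "mrg e c (2 * n) = e n" "mrg e c (Suc (2 * n)) = c n"
  by (simp_all add: mrg_def)

lemma mrg_comp_eqI:
  assumes "\<And>n. f (r (2 * n)) = e n" "\<And>n. f (r (Suc (2 * n))) = c n"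
  shows "f \<circ> r = mrg e c"
proof
  show "(f \<circ> r) n = mrg e c n" for n
    using assms by (cases "even n") (auto elim!: evenE oddE)
qed

context set_structure
begin

text \<open>Since \<open>ren\<close> renames bound variables too, injectivity prevents capture:
  updating at \<open>r i\<close> changes the composed assignment at \<open>i\<close> alone.\<close>

lemma sat_ren: "inj r \<Longrightarrow> sat e (ren r \<phi>) = sat (e \<circ> r) \<phi>"
proof (induction \<phi> arbitrary: e)
  case (FEx i \<phi>)
  have "(e(r i := x)) \<circ> r = (e \<circ> r)(i := x)" for x
    using FEx.prems by (auto simp: fun_eq_iff inj_def)
  then show ?case by (simp only: ren.simps sat.simps FEx.IH[OF FEx.prems])
qed simp_all

lemma sat_cong_fv: "(\<And>i. i \<in> fv \<phi> \<Longrightarrow> e i = e' i) \<Longrightarrow> sat e \<phi> = sat e' \<phi>"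
proof (induction \<phi> arbitrary: e e')
  case (FNot \<phi>)
  show ?case unfolding sat.simps using FNot.IH[of e e'] FNot.prems by simp
next
  case (FAnd \<phi> \<psi>)
  show ?case unfolding sat.simps using FAnd.IH[of e e'] FAnd.prems by simp
next
  case (FEx i \<phi>)
  show ?case
    unfolding sat.simps
    by (intro iff_exI FEx.IH) (use FEx.prems in auto)
qed simp_all

text \<open>
  An assignment interleaves the arguments of a predicate, at the even variables, with a sequence of
  parameters at the odd ones, so that parameters are merged or a fresh variable is freed by an
  injective renaming.
\<close>

definition dfn :: "((nat \<Rightarrow> 'v) \<Rightarrow> bool) \<Rightarrow> bool" where
  "dfn P \<longleftrightarrow> (\<exists>\<phi> c. \<forall>e. P e \<longleftrightarrow> sat (mrg e c) \<phi>)"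

text \<open>A HOL function of the environment counts as a term when its graph is definable. The
  value sits at variable 0 and the environment is shifted by one, the same stack convention as for
  quantifiers.\<close>

definition tm :: "((nat \<Rightarrow> 'v) \<Rightarrow> 'v) \<Rightarrow> bool" where
  "tm t \<longleftrightarrow> dfn (\<lambda>e. e 0 = t (\<lambda>i. e (Suc i)))"

named_theorems dfn_intros

lemma dfn_not [dfn_intros]: "dfn P \<Longrightarrow> dfn (\<lambda>e. \<not> P e)"
  unfolding dfn_def by (metis sat.simps(3))

lemma dfn_and [dfn_intros]:
  assumes "dfn P" "dfn Q"
  shows "dfn (\<lambda>e. P e \<and> Q e)"
proof -
  obtain p c where p: "\<And>e. P e \<longleftrightarrow> sat (mrg e c) p" using assms(1) unfolding dfn_def by blast
  obtain q d where q: "\<And>e. Q e \<longleftrightarrow> sat (mrg e d) q" using assms(2) unfolding dfn_def by blast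
  \<comment> \<open>Both parameter sequences have to share the odd variables: the even ones stay
    fixed, the parameters of \<open>p\<close> go to the residue 1 and those of \<open>q\<close> to
    the residue 3 modulo 4.\<close>
  define r where "r n = (if even n then n else 4 * (n div 2) + 1)" for n :: nat
  define s where "s n = (if even n then n else 4 * (n div 2) + 3)" for n :: nat
  have "inj r" "inj s"
    unfolding inj_def r_def s_def by (auto elim!: evenE oddE) presburger+
  moreover have "r (2 * n) = 2 * n" "r (Suc (2 * n)) = Suc (2 * (2 * n))"
    "s (2 * n) = 2 * n" "s (Suc (2 * n)) = Suc (2 * Suc (2 * n))" for n
    unfolding r_def s_def by simp_all
  then have "mrg e (mrg c d) \<circ> r = mrg e c" "mrg e (mrg c d) \<circ> s = mrg e d" for e
    by (auto intro!: mrg_comp_eqI simp only: mrg_simps)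
  ultimately have "P e \<and> Q e \<longleftrightarrow> sat (mrg e (mrg c d)) (FAnd (ren r p) (ren s q))" for e
    by (simp add: p q sat_ren)
  then show ?thesis unfolding dfn_def by blast
qed

text \<open>
  Quantifier rules treat the environment as a de Bruijn stack: the bound variable becomes \<open>e 0\<close>.
  In this form they match by higher-order pattern unification, so \<open>intro dfn_intros\<close> decomposes
  a predicate along its syntax.
\<close>

lemma dfn_ex [dfn_intros]:
  assumes "dfn (\<lambda>e. R (e 0) (\<lambda>i. e (Suc i)))"
  shows "dfn (\<lambda>e. \<exists>x. R x e)"
proof -
  obtain p c where p: "\<And>e. R (e 0) (\<lambda>i. e (Suc i)) \<longleftrightarrow> sat (mrg e c) p"
    using assms unfolding dfn_def by blast
  \<comment> \<open>The bound argument moves from variable 0 to variable 1, the other arguments move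
    down one place, and the parameters move up one place to free variable 1. Its value
    \<open>undefined\<close> is overwritten by the quantifier.\<close>
  define r where "r n = (if n = 0 then 1 else if even n then n - 2 else n + 2)" for n :: nat
  have r: "inj r" unfolding inj_def r_def by presburger
  have "r (2 * n) = (case n of 0 \<Rightarrow> 1 | Suc k \<Rightarrow> 2 * k)" "r (Suc (2 * n)) = Suc (2 * Suc n)" for n
    unfolding r_def by (auto split: nat.splits)
  then have "(mrg e (case_nat undefined c))(1 := x) \<circ> r = mrg (case_nat x e) c" for e x
    by (auto intro!: mrg_comp_eqI simp del: mult_Suc_right split: nat.splits)
  moreover have "R x e \<longleftrightarrow> sat (mrg (case_nat x e) c) p" for x e
    using p[of "case_nat x e"] by simp
  ultimately have "(\<exists>x. R x e) \<longleftrightarrow> sat (mrg e (case_nat undefined c)) (FEx 1 (ren r p))" for e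
    using r by (simp add: sat_ren)
  then show ?thesis unfolding dfn_def by blast
qed

lemma dfn_or [dfn_intros]:
  assumes "dfn P" "dfn Q"
  shows "dfn (\<lambda>e. P e \<or> Q e)"
proof -
  have "dfn (\<lambda>e. \<not> (\<not> P e \<and> \<not> Q e))" by (intro dfn_not dfn_and assms)
  then show ?thesis by simp
qed

lemma dfn_imp [dfn_intros]:
  assumes "dfn P" "dfn Q"
  shows "dfn (\<lambda>e. P e \<longrightarrow> Q e)"
  unfolding imp_conv_disj by (intro dfn_or dfn_not assms)

lemma dfn_iff [dfn_intros]:
  assumes "dfn P" "dfn Q"
  shows "dfn (\<lambda>e. P e = Q e)"
  unfolding iff_conv_conj_imp by (intro dfn_and dfn_imp assms)

lemma dfn_all [dfn_intros]:
  assumes "dfn (\<lambda>e. R (e 0) (\<lambda>i. e (Suc i)))"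
  shows "dfn (\<lambda>e. \<forall>x. R x e)"
  using dfn_not[OF dfn_ex[of "\<lambda>x e. \<not> R x e"], OF dfn_not[OF assms]] by simp

text \<open>Renaming handles injective changes of arguments; inserting terms, possibly equal ones,
  goes through an existential quantifier as in \<open>dfn_subst1\<close>.\<close>

lemma dfn_inj:
  assumes "dfn P" "inj r"
  shows "dfn (\<lambda>e. P (\<lambda>i. e (r i)))"
proof -
  obtain p c where p: "\<And>e. P e \<longleftrightarrow> sat (mrg e c) p" using assms(1) unfolding dfn_def by blast
  define s where "s n = (if even n then 2 * r (n div 2) else n)" for n :: nat
  have "inj s"
  proof (rule injI)
    fix m n assume "s m = s n"
    moreover from this have "even m \<longleftrightarrow> even n" unfolding s_def by (auto split: if_splits)
    ultimately show "m = n"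
      using assms(2) unfolding s_def by (auto simp: inj_eq elim!: evenE split: if_splits)
  qed
  moreover have "mrg e c \<circ> s = mrg (\<lambda>i. e (r i)) c" for e
    by (auto simp: fun_eq_iff mrg_def s_def)
  ultimately have "P (\<lambda>i. e (r i)) \<longleftrightarrow> sat (mrg e c) (ren s p)" for e
    by (simp add: p sat_ren)
  then show ?thesis unfolding dfn_def by blast
qed

lemma dfn_const [dfn_intros]: "dfn (\<lambda>e. b)"
proof -
  have "dfn (\<lambda>e. True)" unfolding dfn_def by (rule exI[of _ "FEq 0 0"]) simp
  then show ?thesis using dfn_not[of "\<lambda>e. True"] by (cases b) simp_all
qed

lemma dfn_var_eq: "dfn (\<lambda>e. e i = e j)"
  unfolding dfn_def by (rule exI[of _ "FEq (2*i) (2*j)"]) (simp add: mrg_def)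

lemma dfn_var_mem: "dfn (\<lambda>e. e i \<^bold>\<in> e j)"
  unfolding dfn_def by (rule exI[of _ "FMem (2*i) (2*j)"]) (simp add: mrg_def)

lemma tm_var [dfn_intros]: "tm (\<lambda>e. e i)"
  unfolding tm_def by (rule dfn_var_eq)

lemma tm_const [dfn_intros]: "tm (\<lambda>e. c)"
  unfolding tm_def dfn_def
  by (rule exI[of _ "FEq 0 1"], rule exI[of _ "\<lambda>_. c"]) (simp add: mrg_def)

lemma dfn_shift: "dfn P \<Longrightarrow> dfn (\<lambda>e. P (\<lambda>i. e (Suc i)))"
  by (rule dfn_inj) auto

lemma tm_shift: "tm t \<Longrightarrow> tm (\<lambda>e. t (\<lambda>i. e (Suc i)))"
  unfolding tm_def
  using dfn_inj[of "\<lambda>e. e 0 = t (\<lambda>i. e (Suc i))" "case_nat 0 (\<lambda>i. Suc (Suc i))"]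
  by (auto simp: inj_def split: nat.splits)

lemma dfn_subst1:
  assumes "dfn (\<lambda>e. Q (e 0))" "tm t"
  shows "dfn (\<lambda>e. Q (t e))"
proof -
  have "dfn (\<lambda>e. \<exists>x. x = t e \<and> Q x)"
    by (intro dfn_ex dfn_and assms(1)) (use assms(2) in \<open>simp add: tm_def\<close>)
  then show ?thesis by simp
qed

lemma dfn_subst2:
  assumes "dfn (\<lambda>e. Q (e 0) (e 1))" "tm s" "tm t"
  shows "dfn (\<lambda>e. Q (s e) (t e))"
proof -
  have "dfn (\<lambda>e. \<exists>y x. x = s e \<and> y = t e \<and> Q x y)"
  proof (intro dfn_ex dfn_and)
    show "dfn (\<lambda>e. Q (e 0) (e (Suc 0)))" using assms(1) by simp
    show "dfn (\<lambda>e. e 0 = s (\<lambda>i. e (Suc (Suc i))))"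
      using tm_shift[OF assms(2)] by (simp add: tm_def)
    show "dfn (\<lambda>e. e (Suc 0) = t (\<lambda>i. e (Suc (Suc i))))"
      using dfn_shift[OF assms(3)[unfolded tm_def]] by simp
  qed
  then show ?thesis by simp
qed

lemma dfn_subst3:
  assumes "dfn (\<lambda>e. Q (e 0) (e 1) (e 2))" "tm s" "tm t" "tm u"
  shows "dfn (\<lambda>e. Q (s e) (t e) (u e))"
proof -
  have "dfn (\<lambda>e. \<exists>z y x. (x = s e \<and> y = t e \<and> z = u e) \<and> Q x y z)"
  proof (intro dfn_ex dfn_and)
    show "dfn (\<lambda>e. Q (e 0) (e (Suc 0)) (e (Suc (Suc 0))))"
      using assms(1) by (simp add: numeral_2_eq_2)
    show "dfn (\<lambda>e. e 0 = s (\<lambda>i. e (Suc (Suc (Suc i)))))"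
      using tm_shift[OF tm_shift[OF assms(2)]] by (simp add: tm_def)
    show "dfn (\<lambda>e. e (Suc 0) = t (\<lambda>i. e (Suc (Suc (Suc i)))))"
      using dfn_shift[OF tm_shift[OF assms(3), unfolded tm_def]] by simp
    show "dfn (\<lambda>e. e (Suc (Suc 0)) = u (\<lambda>i. e (Suc (Suc (Suc i)))))"
      using dfn_shift[OF dfn_shift[OF assms(4)[unfolded tm_def]]] by simp
  qed
  then show ?thesis by simp
qed

lemma dfn_eq [dfn_intros]: "tm s \<Longrightarrow> tm t \<Longrightarrow> dfn (\<lambda>e. s e = t e)"
  by (rule dfn_subst2[where Q = "(=)"]) (rule dfn_var_eq)

lemma dfn_mem [dfn_intros]: "tm s \<Longrightarrow> tm t \<Longrightarrow> dfn (\<lambda>e. s e \<^bold>\<in> t e)"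
  by (rule dfn_subst2[where Q = "(\<^bold>\<in>)"]) (rule dfn_var_mem)

lemma dfn_ext [dfn_intros]: "tm s \<Longrightarrow> tm t \<Longrightarrow> dfn (\<lambda>e. s e \<in> ext (t e))"
  unfolding ext_def by (simp add: dfn_mem)

lemma tm_subst1: "tm (\<lambda>e. f (e 0)) \<Longrightarrow> tm s \<Longrightarrow> tm (\<lambda>e. f (s e))"
  unfolding tm_def
  using dfn_subst2[of "\<lambda>x y. x = f y" "\<lambda>e. e 0" "\<lambda>e. s (\<lambda>i. e (Suc i))"] tm_shift[of s]
  by (simp add: tm_var tm_def[of s])

lemma tm_subst2: "tm (\<lambda>e. f (e 0) (e 1)) \<Longrightarrow> tm s \<Longrightarrow> tm t \<Longrightarrow> tm (\<lambda>e. f (s e) (t e))"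
  unfolding tm_def[of "\<lambda>e. f (s e) (t e)"] tm_def[of "\<lambda>e. f (e 0) (e 1)"]
  using dfn_subst3[of "\<lambda>x y z. x = f y z" "\<lambda>e. e 0" "\<lambda>e. s (\<lambda>i. e (Suc i))" "\<lambda>e. t (\<lambda>i. e (Suc i))"]
  by (simp add: tm_var tm_shift numeral_2_eq_2)

text \<open>The induction is on a fixed formula outside the model, so no truth definition is
  involved. This lets the measure decide at which coordinates a formula holds.\<close>

lemma dfn_sat:
  assumes "\<And>n. tm (t n)"
  shows "dfn (\<lambda>e. sat (\<lambda>n. t n e) \<phi>)"
  using assms
proof (induction \<phi> arbitrary: t)
  case (FEx i \<phi>)
  define u where "u n = (if n = i then (\<lambda>e. e 0) else (\<lambda>e. t n (\<lambda>k. e (Suc k))))" for n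
  have "tm (u n)" for n
    unfolding u_def using FEx.prems by (simp add: tm_var tm_shift)
  then have "dfn (\<lambda>e. sat (\<lambda>n. u n e) \<phi>)" by (rule FEx.IH)
  moreover have "(\<lambda>n. u n e) = (\<lambda>n. t n (\<lambda>k. e (Suc k)))(i := e 0)" for e
    by (auto simp: u_def)
  ultimately have "dfn (\<lambda>e. sat ((\<lambda>n. t n (\<lambda>k. e (Suc k)))(i := e 0)) \<phi>)" by simp
  then show ?case unfolding sat.simps by (rule dfn_ex)
qed (auto intro: dfn_intros)

end

section \<open>Sets and functions in a model\<close>

context ZFC_structure
begin

definition small :: "'v set \<Rightarrow> bool" where
  "small A \<longleftrightarrow> (\<exists>v. ext v = A)"

text \<open>The value off the small collections is a fixed set, so that definability of \<open>mk\<close> needs no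
  existence proof.\<close>

definition mk :: "'v set \<Rightarrow> 'v" where
  "mk A = (if small A then THE v. ext v = A else undefined)"

lemma small_ext [simp]: "small (ext v)"
  by (auto simp: small_def)

lemma mk_ext [simp]: "mk (ext v) = v"
  unfolding mk_def using Extensionality by auto

lemma ext_mk: "small A \<Longrightarrow> ext (mk A) = A"
  by (metis mk_ext small_def)

lemma ext_inject: "ext x = ext y \<longleftrightarrow> x = y"
  using Extensionality by auto

lemma ext_iff: "x \<in> ext y \<longleftrightarrow> x \<^bold>\<in> y"
  by (simp add: ext_def)

text \<open>Both branches of \<open>mk\<close> are first-order, the default being a parameter.
  Definability of a \<open>mk\<close> term is thereby separated from the proof that the collection
  is a set.\<close>

lemma eq_mk_iff:
  "z = mk {x. Q x} \<longleftrightarrow>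
    (\<forall>x. x \<^bold>\<in> z \<longleftrightarrow> Q x) \<or> \<not> (\<exists>y. \<forall>x. x \<^bold>\<in> y \<longleftrightarrow> Q x) \<and> z = undefined"
proof -
  have *: "ext y = {x. Q x} \<longleftrightarrow> (\<forall>x. x \<^bold>\<in> y \<longleftrightarrow> Q x)" for y
    by (auto simp: ext_def)
  show ?thesis
  proof (cases "small {x. Q x}")
    case True
    then have "z = mk {x. Q x} \<longleftrightarrow> ext z = {x. Q x}" by (metis ext_mk mk_ext)
    with True show ?thesis unfolding small_def * by blast
  next
    case False
    then show ?thesis unfolding mk_def small_def * by auto
  qed
qed

lemma tm_mk:
  assumes "dfn (\<lambda>e. Q (e 0) (\<lambda>i. e (Suc i)))"
  shows "tm (\<lambda>e. mk {x. Q x e})"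
proof -
  have 1: "dfn (\<lambda>e. Q (e 0) (\<lambda>i. e (Suc (Suc i))))"
    using dfn_inj[OF assms, of "case_nat 0 (\<lambda>i. Suc (Suc i))"]
    by (auto simp: inj_def split: nat.splits)
  have 2: "dfn (\<lambda>e. Q (e 0) (\<lambda>i. e (Suc (Suc (Suc i)))))"
    using dfn_inj[OF assms, of "case_nat 0 (\<lambda>i. Suc (Suc (Suc i)))"]
    by (auto simp: inj_def split: nat.splits)
  show ?thesis
    unfolding tm_def eq_mk_iff by (intro dfn_intros 1 2)
qed

lemma dfn_ball [dfn_intros]:
  assumes "tm t" "dfn (\<lambda>e. R (e 0) (\<lambda>i. e (Suc i)))"
  shows "dfn (\<lambda>e. \<forall>x\<in>ext (t e). R x e)"
  unfolding Ball_def by (intro dfn_intros assms(2) tm_shift assms(1))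

lemma dfn_bex [dfn_intros]:
  assumes "tm t" "dfn (\<lambda>e. R (e 0) (\<lambda>i. e (Suc i)))"
  shows "dfn (\<lambda>e. \<exists>x\<in>ext (t e). R x e)"
  unfolding Bex_def by (intro dfn_intros assms(2) tm_shift assms(1))

lemma dfn_subset [dfn_intros]: "tm s \<Longrightarrow> tm t \<Longrightarrow> dfn (\<lambda>e. ext (s e) \<subseteq> ext (t e))"
  by (rule dfn_subst2[where Q = "\<lambda>x y. ext x \<subseteq> ext y"]) (auto simp: subset_eq intro!: dfn_intros)

lemma dfn_empty [dfn_intros]: "tm s \<Longrightarrow> dfn (\<lambda>e. ext (s e) = {})"
  by (rule dfn_subst1[where Q = "\<lambda>x. ext x = {}"])
    (auto simp: set_eq_iff ext_iff intro!: dfn_intros)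

text \<open>Semantic form of Separation: elements fixed in \<open>Q\<close> are absorbed as
  parameters, and only a bounding set has to be exhibited.\<close>

lemma small_Collect:
  assumes "dfn (\<lambda>e. Q (e 0))" "\<And>x. Q x \<Longrightarrow> x \<in> ext a"
  shows "small {x. Q x}"
proof -
  obtain p c where p: "\<And>e. Q (e 0) \<longleftrightarrow> sat (mrg e c) p"
    using assms(1) unfolding dfn_def by blast
  define u :: "nat \<Rightarrow> 'v" where "u = (\<lambda>_. undefined)"
  have "mrg (u(0 := y)) c = (mrg u c)(0 := y)" for y
    by (auto simp: mrg_def fun_eq_iff)
  then have "Q y \<longleftrightarrow> sat ((mrg u c)(0 := y)) p" for y
    using p[of "u(0 := y)"] by simp
  moreover obtain z where "ext z = {y \<in> ext a. sat ((mrg u c)(0 := y)) p}"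
    using Separation by blast
  ultimately have "ext z = {x. Q x}" using assms(2) by auto
  then show ?thesis by (auto simp: small_def)
qed

lemma small_image:
  assumes "tm (\<lambda>e. f (e 0))"
  shows "small (f ` ext a)"
proof -
  have "dfn (\<lambda>e. e 0 = f (e (Suc 0)))" using assms by (simp add: tm_def)
  then obtain p c where p: "\<And>e. e 0 = f (e (Suc 0)) \<longleftrightarrow> sat (mrg e c) p"
    unfolding dfn_def by blast
  define u :: "nat \<Rightarrow> 'v" where "u = (\<lambda>_. undefined)"
  \<comment> \<open>Arguments 0 and 1 occupy the variables 0 and 2 of the merged assignment.\<close>
  have "mrg (u(1 := x, 0 := y)) c = (mrg u c)(2 := x, 0 := y)" for x y
    by (auto simp: mrg_def fun_eq_iff elim!: evenE)
  then have *: "sat ((mrg u c)(2 := x, 0 := y)) p \<longleftrightarrow> y = f x" for x y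
    using p[of "u(1 := x, 0 := y)"] by simp
  have "\<exists>b. ext b = {y. \<exists>x\<in>ext a. sat ((mrg u c)(2 := x, 0 := y)) p}"
    by (rule Replacement) (auto simp: *)
  then show ?thesis unfolding * small_def by (auto simp: image_def Bex_def)
qed

lemma tm_if [dfn_intros]: "dfn (\<lambda>e. P e) \<Longrightarrow> tm s \<Longrightarrow> tm t \<Longrightarrow> tm (\<lambda>e. if P e then s e else t e)"
  unfolding tm_def if_split[of "\<lambda>x. _ = x"]
  by (intro dfn_and dfn_imp dfn_not dfn_shift[of P]) assumption+

section \<open>Elementary set operations as total definable terms\<close>

definition emp :: 'v where "emp = mk {}"

lemma ext_emp [simp]: "ext emp = {}"
proof -
  have "small {x. False}" by (rule small_Collect) (auto intro: dfn_intros)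
  then show ?thesis by (simp add: emp_def ext_mk)
qed

definition upair :: "'v \<Rightarrow> 'v \<Rightarrow> 'v" where "upair x y = mk {x, y}"

lemma ext_upair [simp]: "ext (upair x y) = {x, y}"
  unfolding upair_def by (rule ext_mk) (use Pairing in \<open>auto simp: small_def\<close>)

lemma tm_upair [dfn_intros]: "tm s \<Longrightarrow> tm t \<Longrightarrow> tm (\<lambda>e. upair (s e) (t e))"
proof (rule tm_subst2[where f = upair])
  have "upair x y = mk {z. z = x \<or> z = y}" for x y
    unfolding upair_def by (rule arg_cong[of _ _ mk]) auto
  then show "tm (\<lambda>e. upair (e 0) (e 1))"
    by (simp only:) (intro tm_mk dfn_intros)
qed

definition union :: "'v \<Rightarrow> 'v" where "union x = mk (\<Union>y\<in>ext x. ext y)"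

lemma ext_union [simp]: "ext (union x) = (\<Union>y\<in>ext x. ext y)"
  unfolding union_def by (rule ext_mk) (use Union in \<open>auto simp: small_def\<close>)

lemma tm_union [dfn_intros]: "tm s \<Longrightarrow> tm (\<lambda>e. union (s e))"
proof (rule tm_subst1[where f = union])
  have "union x = mk {z. \<exists>y. y \<in> ext x \<and> z \<in> ext y}" for x
    unfolding union_def by (rule arg_cong[of _ _ mk]) auto
  then show "tm (\<lambda>e. union (e 0))"
    by (simp only:) (intro tm_mk dfn_intros)
qed

definition pow :: "'v \<Rightarrow> 'v" where "pow x = mk {s. ext s \<subseteq> ext x}"

lemma ext_pow [simp]: "ext (pow x) = {s. ext s \<subseteq> ext x}"
  unfolding pow_def by (rule ext_mk) (use Powerset in \<open>auto simp: small_def is_powerset_def\<close>)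

lemma tm_pow [dfn_intros]: "tm s \<Longrightarrow> tm (\<lambda>e. pow (s e))"
  by (rule tm_subst1[where f = pow]) (auto simp: pow_def intro!: tm_mk dfn_intros)

definition un :: "'v \<Rightarrow> 'v \<Rightarrow> 'v" where "un x y = union (upair x y)"

lemma ext_un [simp]: "ext (un x y) = ext x \<union> ext y"
  by (simp add: un_def)

lemma tm_un [dfn_intros]: "tm s \<Longrightarrow> tm t \<Longrightarrow> tm (\<lambda>e. un (s e) (t e))"
  unfolding un_def by (intro dfn_intros)

definition single :: "'v \<Rightarrow> 'v" where "single x = upair x x"

lemma ext_single [simp]: "ext (single x) = {x}"
  by (simp add: single_def)

lemma tm_single [dfn_intros]: "tm s \<Longrightarrow> tm (\<lambda>e. single (s e))"
  unfolding single_def by (intro dfn_intros)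

lemma small_finite: "finite A \<Longrightarrow> small A"
proof (induction rule: finite_induct)
  case empty
  show ?case using small_ext[of emp] by simp
next
  case (insert x A)
  then have "ext (un (single x) (mk A)) = insert x A" by (simp add: ext_mk)
  then show ?case unfolding small_def by (rule exI)
qed

section \<open>Ordered pairs, relations and functions\<close>

definition pair :: "'v \<Rightarrow> 'v \<Rightarrow> 'v" where "pair x y = upair (single x) (upair x y)"

lemma tm_pair [dfn_intros]: "tm s \<Longrightarrow> tm t \<Longrightarrow> tm (\<lambda>e. pair (s e) (t e))"
  unfolding pair_def by (intro dfn_intros)

lemma is_pair_iff: "is_pair p x y \<longleftrightarrow> p = pair x y"
proof
  assume "is_pair p x y"
  then obtain a b where "ext a = {x}" "ext b = {x, y}" "ext p = {a, b}"
    unfolding is_pair_def by blast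
  then have "a = single x" "b = upair x y" "p = upair a b"
    by (simp_all flip: ext_inject)
  then show "p = pair x y" by (simp add: pair_def)
next
  assume "p = pair x y"
  then show "is_pair p x y"
    unfolding is_pair_def by (intro exI[of _ "single x"] exI[of _ "upair x y"]) (simp add: pair_def)
qed

lemma pair_inject [simp]: "pair x y = pair x' y' \<longleftrightarrow> x = x' \<and> y = y'"
proof
  assume "pair x y = pair x' y'"
  then have "{single x, upair x y} = {single x', upair x' y'}"
    by (metis pair_def ext_upair)
  then have "{{x}, {x, y}} = {{x'}, {x', y'}}"
    by (metis ext_single ext_upair image_empty image_insert)
  then show "x = x' \<and> y = y'" by (auto simp: doubleton_eq_iff)
qed simp

lemma rel_iff: "rel r x y \<longleftrightarrow> pair x y \<in> ext r"
  by (auto simp: rel_def is_pair_iff ext_def)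

definition prod :: "'v \<Rightarrow> 'v \<Rightarrow> 'v" where
  "prod a b = mk {p. \<exists>x\<in>ext a. \<exists>y\<in>ext b. p = pair x y}"

lemma ext_prod [simp]: "ext (prod a b) = {p. \<exists>x\<in>ext a. \<exists>y\<in>ext b. p = pair x y}"
  unfolding prod_def
  by (intro ext_mk small_Collect[where a = "pow (pow (un a b))"] dfn_intros)
    (auto simp: pair_def)

lemma relation_on_iff: "relation_on r a b \<longleftrightarrow> ext r \<subseteq> ext (prod a b)"
  by (auto simp: relation_on_def is_pair_iff)

text \<open>The union of all values of the relation \<open>f\<close> at \<open>x\<close>: total, and the value itself where that is unique.\<close>

definition app :: "'v \<Rightarrow> 'v \<Rightarrow> 'v" where
  "app f x = mk {u. \<exists>y. pair x y \<in> ext f \<and> u \<in> ext y}"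

lemma tm_app [dfn_intros]: "tm s \<Longrightarrow> tm t \<Longrightarrow> tm (\<lambda>e. app (s e) (t e))"
  by (rule tm_subst2[where f = app]) (auto simp: app_def intro!: tm_mk dfn_intros)

lemma app_eq: "(\<And>z. pair x z \<in> ext f \<longleftrightarrow> z = y) \<Longrightarrow> app f x = y"
  by (simp add: app_def)

definition lam :: "'v \<Rightarrow> ('v \<Rightarrow> 'v) \<Rightarrow> 'v" where
  "lam a f = mk {p. \<exists>x\<in>ext a. p = pair x (f x)}"

lemma ext_lam:
  assumes "tm (\<lambda>e. f (e 0))"
  shows "ext (lam a f) = (\<lambda>x. pair x (f x)) ` ext a"
proof -
  have "{p. \<exists>x\<in>ext a. p = pair x (f x)} = (\<lambda>x. pair x (f x)) ` ext a" by auto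
  then show ?thesis
    unfolding lam_def by (simp only:) (intro ext_mk small_image dfn_intros assms)
qed

lemma tm_lam [dfn_intros]:
  assumes "tm t" "tm (\<lambda>e. F (e 0) (\<lambda>i. e (Suc i)))"
  shows "tm (\<lambda>e. lam (t e) (\<lambda>x. F x e))"
proof -
  \<comment> \<open>In the graph of \<open>F\<close>, variable 0 holds the value and variable 1
    holds \<open>x\<close>; the renaming leaves a gap at variable 2 for the pair bound by
    \<open>mk\<close>.\<close>
  have r: "inj (\<lambda>i. if i < 2 then i else Suc i)" by (auto simp: inj_def split: if_splits)
  have "tm (\<lambda>e. F (e 0) (\<lambda>i. e (Suc (Suc i))))"
    using dfn_inj[OF assms(2)[unfolded tm_def] r] unfolding tm_def by simp
  then show ?thesis
  unfolding lam_def by (intro tm_mk dfn_intros tm_shift assms(1))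
qed

lemma app_lam: "tm (\<lambda>e. f (e 0)) \<Longrightarrow> x \<in> ext a \<Longrightarrow> app (lam a f) x = f x"
  by (rule app_eq) (auto simp: ext_lam)

lemma is_fun_lam:
  assumes "tm (\<lambda>e. f (e 0))" "\<And>x. x \<in> ext a \<Longrightarrow> f x \<in> ext b"
  shows "is_fun (lam a f) a b"
  using assms(2) by (auto simp: is_fun_def relation_on_iff rel_iff ext_lam[OF assms(1)])

lemma is_fun_rel: "is_fun f a b \<Longrightarrow> rel f x y \<longleftrightarrow> x \<in> ext a \<and> y = app f x"
proof -
  assume f: "is_fun f a b"
  have *: "rel f x y \<Longrightarrow> x \<in> ext a" for x y
    using f by (auto simp: is_fun_def relation_on_iff rel_iff)
  moreover have "rel f x y \<longleftrightarrow> y = app f x" if x: "x \<in> ext a"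
  proof -
    obtain z where "\<And>y. rel f x y \<longleftrightarrow> y = z" using f x unfolding is_fun_def by metis
    then show ?thesis using app_eq[of x f z] unfolding rel_iff by simp
  qed
  ultimately show ?thesis by blast
qed

lemma is_fun_app: "is_fun f a b \<Longrightarrow> x \<in> ext a \<Longrightarrow> app f x \<in> ext b"
proof -
  assume f: "is_fun f a b" and x: "x \<in> ext a"
  then have "pair x (app f x) \<in> ext f" using is_fun_rel[OF f] by (simp add: rel_iff)
  then show ?thesis using f by (auto simp: is_fun_def relation_on_iff)
qed

lemma is_fun_eq_lam: "is_fun f a b \<Longrightarrow> f = lam a (app f)"
proof -
  assume f: "is_fun f a b"
  have "p \<in> ext f \<longleftrightarrow> (\<exists>x\<in>ext a. p = pair x (app f x))" for p
  proof
    assume p: "p \<in> ext f"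
    then obtain x y where "p = pair x y" using f by (auto simp: is_fun_def relation_on_iff)
    then show "\<exists>x\<in>ext a. p = pair x (app f x)" using p is_fun_rel[OF f, of x y] by (auto simp: rel_iff)
  next
    assume "\<exists>x\<in>ext a. p = pair x (app f x)"
    then show "p \<in> ext f" using is_fun_rel[OF f] by (auto simp: rel_iff)
  qed
  then show ?thesis
    by (auto simp: ext_lam dfn_intros simp flip: ext_inject)
qed

lemma is_fun_mono: "is_fun f a b \<Longrightarrow> (\<And>x. x \<in> ext a \<Longrightarrow> app f x \<in> ext c) \<Longrightarrow> is_fun f a c"
  using is_fun_lam[of "app f" a c] is_fun_eq_lam[of f a b] by (simp add: tm_app tm_const tm_var)

lemma dfn_is_fun [dfn_intros]: "tm s \<Longrightarrow> tm t \<Longrightarrow> tm u \<Longrightarrow> dfn (\<lambda>e. is_fun (s e) (t e) (u e))"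
  by (rule dfn_subst3[where Q = is_fun])
    (auto simp: is_fun_def relation_on_def is_pair_iff rel_iff Ex1_def intro!: dfn_intros)

definition funs :: "'v \<Rightarrow> 'v \<Rightarrow> 'v" where
  "funs a b = mk {f. is_fun f a b}"

lemma ext_funs [simp]: "ext (funs a b) = {f. is_fun f a b}"
  unfolding funs_def
  by (intro ext_mk small_Collect[where a = "pow (prod a b)"] dfn_intros)
    (auto simp: is_fun_def relation_on_iff)

text \<open>The axiom speaks of disjoint families. Tagging the candidates for \<open>x\<close> as
  pairs with first component \<open>x\<close> makes the sets \<open>G x\<close> disjoint, and the
  transversal cut down to such pairs is the function.\<close>

lemma choice_fun:
  assumes R: "dfn (\<lambda>e. R (e 0) (e 1))" and ex: "\<And>x. x \<in> ext a \<Longrightarrow> \<exists>y\<in>ext b. R x y"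
  obtains f where "is_fun f a b" "\<And>x. x \<in> ext a \<Longrightarrow> R x (app f x)"
proof -
  have R': "tm s \<Longrightarrow> tm t \<Longrightarrow> dfn (\<lambda>e. R (s e) (t e))" for s t
    by (rule dfn_subst2[OF R])
  define G where "G x = mk {p. \<exists>y\<in>ext b. R x y \<and> p = pair x y}" for x
  have G: "ext (G x) = {p. \<exists>y\<in>ext b. R x y \<and> p = pair x y}" if "x \<in> ext a" for x
    unfolding G_def
    by (intro ext_mk small_Collect[where a = "prod a b"] dfn_intros R') (use that in auto)
  have "tm (\<lambda>e. G (e 0))" unfolding G_def by (intro tm_mk dfn_intros R')
  then have sm: "small (G ` ext a)" by (rule small_image)
  have "\<exists>c. \<forall>y\<in>ext (mk (G ` ext a)). \<exists>!z. z \<^bold>\<in> c \<and> z \<^bold>\<in> y"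
  proof (rule Choice)
    have *: "y \<^bold>\<in> mk (G ` ext a) \<longleftrightarrow> y \<in> G ` ext a" for y
      using ext_iff[of y "mk (G ` ext a)"] ext_mk[OF sm] by simp
    show "ext y \<noteq> {}" if y: "y \<^bold>\<in> mk (G ` ext a)" for y
    proof -
      obtain x where x: "x \<in> ext a" "y = G x" using y unfolding * by auto
      obtain v where "v \<in> ext b" "R x v" using ex[OF x(1)] by blast
      then show ?thesis unfolding x(2) G[OF x(1)] by blast
    qed
    show "ext y \<inter> ext z = {}" if "y \<^bold>\<in> mk (G ` ext a)" "z \<^bold>\<in> mk (G ` ext a)" "y \<noteq> z" for y z
      using that unfolding * by (auto simp: G)
  qed
  then obtain c where c: "\<And>x. x \<in> ext a \<Longrightarrow> \<exists>!z. z \<in> ext c \<and> z \<in> ext (G x)"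
    unfolding ext_mk[OF sm] by (auto simp: ext_def)
  define f where "f = mk {p. p \<in> ext c \<and> (\<exists>x\<in>ext a. \<exists>y\<in>ext b. R x y \<and> p = pair x y)}"
  have f: "ext f = {p. p \<in> ext c \<and> (\<exists>x\<in>ext a. \<exists>y\<in>ext b. R x y \<and> p = pair x y)}"
    unfolding f_def
    by (intro ext_mk small_Collect[where a = "c"] dfn_intros R') auto
  have "is_fun f a b"
    unfolding is_fun_def relation_on_iff rel_iff
  proof (intro conjI ballI)
    fix x assume x: "x \<in> ext a"
    then obtain z where z: "z \<in> ext c" "z \<in> ext (G x)" "\<And>z'. z' \<in> ext c \<Longrightarrow> z' \<in> ext (G x) \<Longrightarrow> z' = z"
      using c[OF x] by blast
    then obtain y where y: "y \<in> ext b" "R x y" "z = pair x y" using G[OF x] by blast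
    show "\<exists>!y. pair x y \<in> ext f"
    proof (rule ex1I[of _ y])
      show "pair x y \<in> ext f" using z(1) y x by (auto simp: f)
      fix y' assume "pair x y' \<in> ext f"
      then have "pair x y' \<in> ext c" "pair x y' \<in> ext (G x)" by (auto simp: f G[OF x])
      then have "pair x y' = z" by (rule z(3))
      then show "y' = y" using y(3) by simp
    qed
  qed (auto simp: f)
  moreover have "R x (app f x)" if "x \<in> ext a" for x
    using is_fun_rel[OF calculation, of x "app f x"] that by (auto simp: rel_iff f)
  ultimately show ?thesis by (rule that)
qed

subsection \<open>Wellfounded recursion\<close>

definition restr :: "('v \<Rightarrow> 'v \<Rightarrow> bool) \<Rightarrow> 'v \<Rightarrow> 'v \<Rightarrow> 'v \<Rightarrow> 'v" where
  "restr R d f x = mk {p. \<exists>y\<in>ext d. R y x \<and> p = pair y (app f y)}"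

text \<open>Wellfoundedness as the model sees it: only subsets that are elements count. Induction
  along \<open>R\<close> is therefore restricted to definable predicates.\<close>

definition wf_on_set :: "'v \<Rightarrow> ('v \<Rightarrow> 'v \<Rightarrow> bool) \<Rightarrow> bool" where
  "wf_on_set d R \<longleftrightarrow> (\<forall>s. ext s \<subseteq> ext d \<longrightarrow> ext s \<noteq> {} \<longrightarrow> (\<exists>m\<in>ext s. \<forall>y\<in>ext s. \<not> R y m))"

lemma wf_on_set_induct [consumes 1, case_names wf dfn step]:
  assumes "x \<in> ext d" and wf: "wf_on_set d R" and Q: "dfn (\<lambda>e. Q (e 0))"
    and step: "\<And>x. x \<in> ext d \<Longrightarrow> (\<And>y. y \<in> ext d \<Longrightarrow> R y x \<Longrightarrow> Q y) \<Longrightarrow> Q x"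
  shows "Q x"
proof (rule ccontr)
  assume "\<not> Q x"
  define s where "s = mk {y. y \<in> ext d \<and> \<not> Q y}"
  have s: "ext s = {y. y \<in> ext d \<and> \<not> Q y}"
    unfolding s_def by (intro ext_mk small_Collect[where a = d] dfn_intros Q) auto
  moreover have "\<exists>m\<in>ext s. \<forall>y\<in>ext s. \<not> R y m"
    using wf[unfolded wf_on_set_def, rule_format, of s] assms(1) \<open>\<not> Q x\<close> s by blast
  ultimately show False using step by blast
qed

lemma restr_cong:
  "(\<And>y. y \<in> ext d \<Longrightarrow> R y x \<Longrightarrow> app f y = app g y) \<Longrightarrow> restr R d f x = restr R d g x"
  unfolding restr_def by (rule arg_cong[of _ _ mk]) auto

text \<open>Partial solutions on subsets of \<open>d\<close> closed under
  \<open>R\<close>-predecessors agree by induction. Hence \<open>V\<close> can read off their common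
  value without choosing one, and the union \<open>A\<close> of their domains exhausts
  \<open>d\<close>.\<close>

lemma wf_recursion_restr:
  assumes wf: "wf_on_set d R" and R: "dfn (\<lambda>e. R (e 0) (e 1))" and H: "tm (\<lambda>e. H (e 0) (e 1))"
  obtains F where "F = lam d (app F)"
    "\<And>x. x \<in> ext d \<Longrightarrow> app F x = H x (restr R d F x)"
proof -
  note R' = dfn_subst2[OF R] and H' = tm_subst2[OF H]
  have restr': "tm s \<Longrightarrow> tm t \<Longrightarrow> tm (\<lambda>e. restr R d (s e) (t e))" for s t
    by (rule tm_subst2[where f = "restr R d"])
      (auto simp: restr_def intro!: tm_mk dfn_intros R')
  define approx where "approx a g \<longleftrightarrow> ext a \<subseteq> ext d \<and>
    (\<forall>x\<in>ext a. \<forall>y\<in>ext d. R y x \<longrightarrow> y \<in> ext a) \<and>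
    (\<forall>x\<in>ext a. app g x = H x (restr R d g x))" for a g
  have agree: "app g x = app h x" if "approx a g" "approx b h" "x \<in> ext a" "x \<in> ext b" for a g b h x
  proof -
    have "x \<in> ext d" using that unfolding approx_def by blast
    then have "x \<in> ext a \<longrightarrow> x \<in> ext b \<longrightarrow> app g x = app h x"
    proof (induction rule: wf_on_set_induct[where R = R])
      case wf
      show ?case by (rule assms(1))
    next
      case dfn
      show ?case by (intro dfn_intros)
    next
      case (step x)
      show ?case
      proof (intro impI)
        assume x: "x \<in> ext a" "x \<in> ext b"
        then have "restr R d g x = restr R d h x"
          using step that(1,2) unfolding approx_def by (intro restr_cong) blast
        then show "app g x = app h x" using x that(1,2) by (simp add: approx_def)
      qed
    qed
    then show ?thesis using that by blast
  qed
  have approx': "tm s \<Longrightarrow> tm t \<Longrightarrow> dfn (\<lambda>e. approx (s e) (t e))" for s t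
    by (rule dfn_subst2[where Q = approx])
      (auto simp: approx_def intro!: dfn_intros H' R' restr')
  define V where "V x = mk {u. \<exists>a g. approx a g \<and> x \<in> ext a \<and> u \<in> ext (app g x)}" for x
  have V: "V x = app g x" if "approx a g" "x \<in> ext a" for a g x
  proof -
    have "{u. \<exists>a g. approx a g \<and> x \<in> ext a \<and> u \<in> ext (app g x)} = ext (app g x)"
    proof (intro Set.set_eqI iffI)
      fix u assume "u \<in> {u. \<exists>a g. approx a g \<and> x \<in> ext a \<and> u \<in> ext (app g x)}"
      then obtain b h where "approx b h" "x \<in> ext b" "u \<in> ext (app h x)" by blast
      then show "u \<in> ext (app g x)" using agree[OF that(1) _ that(2), of b h] by simp
    qed (use that in blast)
    then show ?thesis by (simp add: V_def)
  qed
  have tmV: "tm (\<lambda>e. V (e 0))"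
    unfolding V_def by (intro tm_mk dfn_intros approx')
  define A where "A = mk {x. \<exists>a g. approx a g \<and> x \<in> ext a}"
  have A: "ext A = {x. \<exists>a g. approx a g \<and> x \<in> ext a}"
    unfolding A_def
    by (intro ext_mk small_Collect[where a = d] dfn_intros approx') (auto simp: approx_def)
  define G where "G = lam A V"
  have G: "app G x = V x" if "x \<in> ext A" for x
    unfolding G_def by (intro app_lam tmV that)
  have closedA: "y \<in> ext A" if "x \<in> ext A" "y \<in> ext d" "R y x" for x y
    using that unfolding A approx_def by blast
  have approxG: "approx A G"
    unfolding approx_def
  proof (intro conjI ballI impI)
    show "ext A \<subseteq> ext d" by (auto simp: A approx_def)
    show "y \<in> ext A" if "x \<in> ext A" "y \<in> ext d" "R y x" for x y
      using that by (rule closedA)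
    fix x assume x: "x \<in> ext A"
    then obtain a g where a: "approx a g" "x \<in> ext a" by (auto simp: A)
    have "restr R d G x = restr R d g x"
    proof (rule restr_cong)
      fix y assume y: "y \<in> ext d" "R y x"
      then have "y \<in> ext a" using a by (auto simp: approx_def)
      then show "app G y = app g y" using V[OF a(1)] G closedA[OF x y] by simp
    qed
    then show "app G x = H x (restr R d G x)"
      using a by (simp add: G[OF x] V[OF a] approx_def)
  qed
  have "x \<in> ext A" if "x \<in> ext d" for x
    using that
  proof (induction rule: wf_on_set_induct[where R = R])
    case wf
    show ?case by (rule assms(1))
  next
    case dfn
    show ?case by (intro dfn_intros)
  next
    case (step x)
    show ?case
    proof (rule ccontr)
      assume x: "x \<notin> ext A"
      \<comment> \<open>As \<open>x\<close> is outside \<open>A\<close> while its predecessors are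
        inside, \<open>x\<close> is below neither itself nor any member of \<open>A\<close>. Adding
        a value at \<open>x\<close> therefore changes no restriction, and the extended map is again
        a partial solution.\<close>
      have nR: "\<not> R x x" using step x by blast
      have nR2: "\<not> R x y" if "y \<in> ext A" for y using closedA[OF that] step(1) x by blast
      define g where "g = un G (single (pair x (H x (restr R d G x))))"
      have g1: "app g y = app G y" if "y \<noteq> x" for y
        unfolding g_def app_def using that by simp
      have "pair x z \<notin> ext G" for z
        unfolding G_def ext_lam[OF tmV] using x by auto
      then have g2: "app g x = H x (restr R d G x)"
        by (intro app_eq) (auto simp: g_def)
      have g3: "restr R d g y = restr R d G y" if "y \<in> ext (un A (single x))" for y
        using that nR nR2 by (intro restr_cong g1) auto
      have "approx (un A (single x)) g"
        unfolding approx_def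
      proof (intro conjI ballI impI)
        show "ext (un A (single x)) \<subseteq> ext d"
          using step(1) by (auto simp: A approx_def)
        show "z \<in> ext (un A (single x))" if "y \<in> ext (un A (single x))" "z \<in> ext d" "R z y" for y z
          using that step closedA by auto
        show "app g y = H y (restr R d g y)" if "y \<in> ext (un A (single x))" for y
          using that g1 g2 g3[OF that] approxG x by (cases "y = x") (auto simp: approx_def)
      qed
      then have "x \<in> ext A" by (auto simp: A)
      then show False using x by simp
    qed
  qed
  moreover have "ext A \<subseteq> ext d" by (auto simp: A approx_def)
  ultimately have Ad: "A = d" by (intro Extensionality) auto
  have "is_fun G d (mk (V ` ext d))"
    unfolding G_def Ad using ext_mk[OF small_image[OF tmV]] by (intro is_fun_lam tmV) auto
  then have "G = lam d (app G)" by (rule is_fun_eq_lam)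
  then show ?thesis using approxG by (intro that) (auto simp: approx_def Ad)
qed

theorem wf_recursion:
  assumes wf: "wf_on_set d R" and R: "dfn (\<lambda>e. R (e 0) (e 1))" and H: "tm (\<lambda>e. H (e 0) (e 1))"
  obtains F where "F = lam d (app F)"
    "\<And>x. x \<in> ext d \<Longrightarrow> \<exists>p. app F x = H x p \<and>
      ext p = {q. \<exists>y\<in>ext d. R y x \<and> q = pair y (app F y)}"
proof -
  obtain F where F: "F = lam d (app F)"
    "\<And>x. x \<in> ext d \<Longrightarrow> app F x = H x (restr R d F x)"
    using wf_recursion_restr[OF assms] by blast
  have "ext (restr R d F x) = {q. \<exists>y\<in>ext d. R y x \<and> q = pair y (app F y)}" for x
    unfolding restr_def
  proof (intro ext_mk small_Collect[where a = F] dfn_intros dfn_subst2[OF R])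
    fix q assume "\<exists>y\<in>ext d. R y x \<and> q = pair y (app F y)"
    then have "q \<in> ext (lam d (app F))" by (auto simp: ext_lam tm_app tm_const tm_var)
    then show "q \<in> ext F" using F(1) by simp
  qed
  then show ?thesis using F by (intro that) blast+
qed

lemma foundation: "ext s \<noteq> {} \<Longrightarrow> \<exists>m\<in>ext s. \<forall>x\<in>ext s. x \<notin> ext m"
  using Foundation[of s] by blast

lemma wf_mem: "wf_on_set d (\<lambda>x y. x \<in> ext y)"
  unfolding wf_on_set_def using foundation by blast

lemma mem_irrefl [simp]: "x \<notin> ext x"
  using foundation[of "single x"] by auto

lemma mem_asym: "x \<in> ext y \<Longrightarrow> y \<notin> ext x"
  using foundation[of "upair x y"] by auto

lemma mem_no_3cycle: "x \<in> ext y \<Longrightarrow> y \<in> ext z \<Longrightarrow> z \<notin> ext x"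
  using foundation[of "un (single x) (upair y z)"] by auto

subsection \<open>Ordinals\<close>

definition transitive :: "'v \<Rightarrow> bool" where
  "transitive x \<longleftrightarrow> (\<forall>y\<in>ext x. ext y \<subseteq> ext x)"

lemma transitiveD: "transitive x \<Longrightarrow> y \<in> ext x \<Longrightarrow> z \<in> ext y \<Longrightarrow> z \<in> ext x"
  by (auto simp: transitive_def)

text \<open>Foundation supplies the remaining clauses of a wellordering: minimal elements,
  irreflexivity and, by excluding membership cycles of length two and three, transitivity of
  membership.\<close>

lemma ordinal_iff: "ordinal \<alpha> \<longleftrightarrow> transitive \<alpha> \<and>
  (\<forall>x\<in>ext \<alpha>. \<forall>y\<in>ext \<alpha>. x \<in> ext y \<or> x = y \<or> y \<in> ext x)" (is "_ \<longleftrightarrow> _ \<and> ?lin")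
proof
  assume "ordinal \<alpha>"
  note * = this[unfolded ordinal_def strictly_wellorders_def]
  have "\<forall>y\<in>ext \<alpha>. ext y \<subseteq> ext \<alpha>" using * by (rule conjunct1)
  moreover have "\<forall>x\<in>ext \<alpha>. \<forall>y\<in>ext \<alpha>. x \<^bold>\<in> y \<or> x = y \<or> y \<^bold>\<in> x" using * by (elim conjE)
  ultimately show "transitive \<alpha> \<and> ?lin"
    unfolding transitive_def by (simp add: ext_iff)
next
  assume *: "transitive \<alpha> \<and> ?lin"
  have 1: "\<forall>\<beta>\<in>ext \<alpha>. ext \<beta> \<subseteq> ext \<alpha>" using * by (simp add: transitive_def)
  have 2: "\<forall>x\<in>ext \<alpha>. \<not> x \<^bold>\<in> x" by (simp flip: ext_iff)
  have 3: "\<forall>x\<in>ext \<alpha>. \<forall>y\<in>ext \<alpha>. \<forall>z\<in>ext \<alpha>. x \<^bold>\<in> y \<longrightarrow> y \<^bold>\<in> z \<longrightarrow> x \<^bold>\<in> z"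
  proof (intro ballI impI)
    fix x y z assume "x \<in> ext \<alpha>" "y \<in> ext \<alpha>" "z \<in> ext \<alpha>" "x \<^bold>\<in> y" "y \<^bold>\<in> z"
    then have that: "x \<in> ext \<alpha>" "z \<in> ext \<alpha>" "x \<in> ext y" "y \<in> ext z" by (simp_all add: ext_iff)
    have "x \<noteq> z" using that mem_asym by blast
    moreover have "z \<notin> ext x" using that mem_no_3cycle by blast
    ultimately have "x \<in> ext z" using * that by blast
    then show "x \<^bold>\<in> z" by (simp add: ext_iff)
  qed
  have 4: "\<forall>x\<in>ext \<alpha>. \<forall>y\<in>ext \<alpha>. x \<^bold>\<in> y \<or> x = y \<or> y \<^bold>\<in> x"
    using * unfolding ext_iff by (rule conjunct2)
  have 5: "\<forall>s. ext s \<subseteq> ext \<alpha> \<longrightarrow> ext s \<noteq> {} \<longrightarrow> (\<exists>m\<in>ext s. \<forall>x\<in>ext s. x = m \<or> m \<^bold>\<in> x)"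
  proof (intro allI impI)
    fix s assume s: "ext s \<subseteq> ext \<alpha>" "ext s \<noteq> {}"
    obtain m where m: "m \<in> ext s" "\<forall>x\<in>ext s. x \<notin> ext m" using foundation[OF s(2)] by blast
    then have "\<forall>x\<in>ext s. x = m \<or> m \<in> ext x" using * s(1) by blast
    then show "\<exists>m\<in>ext s. \<forall>x\<in>ext s. x = m \<or> m \<^bold>\<in> x" using m(1) by (auto simp: ext_iff)
  qed
  show "ordinal \<alpha>"
    unfolding ordinal_def strictly_wellorders_def by (intro conjI 1 2 3 4 5)
qed

lemma dfn_transitive [dfn_intros]: "tm t \<Longrightarrow> dfn (\<lambda>e. transitive (t e))"
  by (rule dfn_subst1[where Q = transitive]) (auto simp: transitive_def intro!: dfn_intros)

lemma dfn_ordinal [dfn_intros]: "tm t \<Longrightarrow> dfn (\<lambda>e. ordinal (t e))"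
  by (rule dfn_subst1[where Q = ordinal]) (auto simp: ordinal_iff intro!: dfn_intros)

lemma ordinal_transitive: "ordinal \<alpha> \<Longrightarrow> transitive \<alpha>"
  by (simp add: ordinal_iff)

lemma ordinal_mem:
  assumes "ordinal \<alpha>" "\<beta> \<in> ext \<alpha>"
  shows "ordinal \<beta>"
proof -
  have sub: "ext \<beta> \<subseteq> ext \<alpha>" using assms by (auto simp: ordinal_iff transitive_def)
  have "z \<in> ext \<beta>" if "y \<in> ext \<beta>" "z \<in> ext y" for y z
  proof -
    have y: "y \<in> ext \<alpha>" using that sub by blast
    then have "z \<in> ext \<alpha>" using that assms unfolding ordinal_iff transitive_def by blast
    moreover have "z \<noteq> \<beta>" using that mem_asym by blast
    moreover have "\<beta> \<notin> ext z" using that mem_no_3cycle by blast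
    ultimately show ?thesis using assms by (auto simp: ordinal_iff)
  qed
  then have "transitive \<beta>" by (auto simp: transitive_def)
  moreover have "\<forall>x\<in>ext \<beta>. \<forall>y\<in>ext \<beta>. x \<in> ext y \<or> x = y \<or> y \<in> ext x"
    using assms(1) sub unfolding ordinal_iff by blast
  ultimately show ?thesis unfolding ordinal_iff by simp
qed

lemma ordinal_subset:
  assumes "ordinal \<alpha>" "ordinal \<beta>" "ext \<alpha> \<subseteq> ext \<beta>"
  shows "\<alpha> = \<beta> \<or> \<alpha> \<in> ext \<beta>"
proof (cases "ext \<beta> \<subseteq> ext \<alpha>")
  case True
  then show ?thesis using assms Extensionality by auto
next
  case False
  define s where "s = mk {x. x \<in> ext \<beta> \<and> x \<notin> ext \<alpha>}"
  have s: "ext s = {x. x \<in> ext \<beta> \<and> x \<notin> ext \<alpha>}"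
    unfolding s_def by (intro ext_mk small_Collect[where a = \<beta>] dfn_intros) auto
  then obtain m where m: "m \<in> ext \<beta>" "m \<notin> ext \<alpha>" "\<And>x. x \<in> ext \<beta> \<Longrightarrow> x \<notin> ext \<alpha> \<Longrightarrow> x \<notin> ext m"
    using foundation[of s] False by auto
  have "ext m = ext \<alpha>"
  proof
    show "ext m \<subseteq> ext \<alpha>" using m transitiveD[OF ordinal_transitive[OF assms(2)] m(1)] by blast
    show "ext \<alpha> \<subseteq> ext m"
    proof
      fix x assume x: "x \<in> ext \<alpha>"
      then have "m \<noteq> x" "m \<notin> ext x" using m(2) transitiveD[OF ordinal_transitive[OF assms(1)]] by auto
      then show "x \<in> ext m" using assms(2,3) m(1) x unfolding ordinal_iff by blast
    qed
  qed
  then show ?thesis using m(1) Extensionality by blast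
qed

lemma ordinal_linear:
  assumes "ordinal \<alpha>" "ordinal \<beta>"
  shows "\<alpha> \<in> ext \<beta> \<or> \<alpha> = \<beta> \<or> \<beta> \<in> ext \<alpha>"
proof -
  define s where "s = mk {x. x \<in> ext \<beta> \<and> x \<in> ext \<alpha>}"
  have s: "ext s = {x. x \<in> ext \<beta> \<and> x \<in> ext \<alpha>}"
    unfolding s_def by (intro ext_mk small_Collect[where a = \<beta>] dfn_intros) auto
  have "ordinal s" using assms by (auto simp: ordinal_iff transitive_def s)
  then have "s = \<alpha> \<or> s \<in> ext \<alpha>" "s = \<beta> \<or> s \<in> ext \<beta>"
    using assms ordinal_subset[of s \<alpha>] ordinal_subset[of s \<beta>] by (auto simp: s)
  moreover have "\<not> (s \<in> ext \<alpha> \<and> s \<in> ext \<beta>)" using s mem_irrefl[of s] by blast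
  ultimately show ?thesis by blast
qed

lemma ordinal_not_mem: "ordinal \<alpha> \<Longrightarrow> ordinal \<beta> \<Longrightarrow> \<beta> \<notin> ext \<alpha> \<Longrightarrow> ext \<alpha> \<subseteq> ext \<beta>"
  using ordinal_linear[of \<alpha> \<beta>] ordinal_transitive[of \<beta>] by (auto simp: transitive_def)

text \<open>Collecting the members of a membership-minimal element, instead of describing that
  element, makes this a total term. In a nonempty set of ordinals there is just one such
  element.\<close>

definition least :: "'v \<Rightarrow> 'v" where
  "least s = mk {u. \<exists>m\<in>ext s. (\<forall>x\<in>ext s. x \<notin> ext m) \<and> u \<in> ext m}"

lemma tm_least [dfn_intros]: "tm t \<Longrightarrow> tm (\<lambda>e. least (t e))"
  by (rule tm_subst1[where f = least]) (auto simp: least_def intro!: tm_mk dfn_intros)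

lemma least:
  assumes "ext s \<noteq> {}" "\<And>x. x \<in> ext s \<Longrightarrow> ordinal x"
  shows "least s \<in> ext s" "\<And>x. x \<in> ext s \<Longrightarrow> x \<notin> ext (least s)"
proof -
  obtain m where m: "m \<in> ext s" "\<forall>x\<in>ext s. x \<notin> ext m" using foundation[OF assms(1)] by blast
  then have "n = m" if "n \<in> ext s" "\<forall>x\<in>ext s. x \<notin> ext n" for n
    using that ordinal_linear[of n m] assms(2) by blast
  then have "{u. \<exists>m\<in>ext s. (\<forall>x\<in>ext s. x \<notin> ext m) \<and> u \<in> ext m} = ext m" using m by blast
  then have "least s = m" by (simp add: least_def)
  then show "least s \<in> ext s" "\<And>x. x \<in> ext s \<Longrightarrow> x \<notin> ext (least s)" using m by auto
qed

subsection \<open>Equipotence and cardinals\<close>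

lemma is_bij_iff: "is_bij f a b \<longleftrightarrow> is_fun f a b \<and> bij_betw (app f) (ext a) (ext b)"
proof (cases "is_fun f a b")
  case True
  have "(\<forall>y\<in>ext b. \<exists>!x. rel f x y) \<longleftrightarrow> bij_betw (app f) (ext a) (ext b)"
  proof
    assume *: "\<forall>y\<in>ext b. \<exists>!x. rel f x y"
    show "bij_betw (app f) (ext a) (ext b)"
      unfolding bij_betw_def inj_on_def
    proof (intro conjI ballI impI)
      fix x y assume "x \<in> ext a" "y \<in> ext a" "app f x = app f y"
      then have "rel f x (app f x)" "rel f y (app f x)" "app f x \<in> ext b"
        using is_fun_rel[OF True] is_fun_app[OF True] by auto
      then show "x = y" using * by blast
    next
      show "app f ` ext a = ext b"
      proof
        show "app f ` ext a \<subseteq> ext b" using is_fun_app[OF True] by auto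
        show "ext b \<subseteq> app f ` ext a" using * is_fun_rel[OF True] by blast
      qed
    qed
  next
    assume *: "bij_betw (app f) (ext a) (ext b)"
    show "\<forall>y\<in>ext b. \<exists>!x. rel f x y"
    proof
      fix y assume "y \<in> ext b"
      then obtain x where x: "x \<in> ext a" "y = app f x" using * by (auto simp: bij_betw_def)
      show "\<exists>!x. rel f x y"
      proof (rule ex1I[of _ x])
        show "rel f x y" using x is_fun_rel[OF True] by simp
        fix x' assume "rel f x' y"
        then have "x' \<in> ext a" "app f x' = app f x" using x is_fun_rel[OF True] by auto
        then show "x' = x" using * x by (auto simp: bij_betw_def inj_on_def)
      qed
    qed
  qed
  with True show ?thesis by (simp add: is_bij_def)
qed (simp add: is_bij_def)

lemma equipotentI:
  assumes "tm (\<lambda>e. f (e 0))" "bij_betw f (ext a) (ext b)"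
  shows "equipotent a b"
proof -
  have "bij_betw (app (lam a f)) (ext a) (ext b)"
    using assms(2) by (rule bij_betw_cong[THEN iffD1, rotated]) (simp add: app_lam assms(1))
  moreover have "is_fun (lam a f) a b"
    using assms by (intro is_fun_lam) (auto simp: bij_betw_def)
  ultimately show ?thesis unfolding equipotent_def is_bij_iff by blast
qed

lemma equipotent_sym:
  assumes "equipotent a b"
  shows "equipotent b a"
proof -
  obtain f where f: "is_fun f a b" "bij_betw (app f) (ext a) (ext b)"
    using assms unfolding equipotent_def is_bij_iff by blast
  define g where "g y = mk {u. \<exists>x\<in>ext a. app f x = y \<and> u \<in> ext x}" for y
  have g: "g (app f x) = x" if "x \<in> ext a" for x
  proof -
    have "{u. \<exists>x'\<in>ext a. app f x' = app f x \<and> u \<in> ext x'} = ext x"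
      using that f(2) unfolding bij_betw_def inj_on_def by blast
    then show ?thesis by (simp add: g_def)
  qed
  have "bij_betw g (ext b) (ext a)"
    by (rule bij_betw_byWitness[where f' = "app f"])
      (use f(2) g in \<open>auto simp: bij_betw_def dest!: equalityD2[THEN subsetD]\<close>)
  moreover have "tm (\<lambda>e. g (e 0))" unfolding g_def by (intro tm_mk dfn_intros)
  ultimately show ?thesis by (rule equipotentI[rotated])
qed

lemma equipotent_trans:
  assumes "equipotent a b" "equipotent b c"
  shows "equipotent a c"
proof -
  obtain f g where "bij_betw (app f) (ext a) (ext b)" "bij_betw (app g) (ext b) (ext c)"
    using assms unfolding equipotent_def is_bij_iff by blast
  then have "bij_betw (\<lambda>x. app g (app f x)) (ext a) (ext c)"
    using bij_betw_trans by (fastforce simp: comp_def)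
  then show ?thesis by (rule equipotentI[rotated]) (intro dfn_intros)
qed

lemma equipotent_refl: "equipotent a a"
  by (rule equipotentI[where f = "\<lambda>x. x"]) (auto intro: dfn_intros simp: bij_betw_def)

lemma dfn_equipotent [dfn_intros]: "tm s \<Longrightarrow> tm t \<Longrightarrow> dfn (\<lambda>e. equipotent (s e) (t e))"
  by (rule dfn_subst2[where Q = equipotent])
    (auto simp: equipotent_def is_bij_def rel_iff Ex1_def intro!: dfn_intros)

lemma cardinal_ordinal: "cardinal \<kappa> \<Longrightarrow> ordinal \<kappa>"
  by (simp add: cardinal_def)

lemma ex_cardinal:
  assumes "ordinal \<alpha>"
  obtains l where "cardinal l" "equipotent l \<alpha>" "l = \<alpha> \<or> l \<in> ext \<alpha>"
proof -
  define s where "s = mk {\<beta>. \<beta> \<in> ext (un \<alpha> (single \<alpha>)) \<and> equipotent \<beta> \<alpha>}"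
  have s: "ext s = {\<beta>. \<beta> \<in> ext (un \<alpha> (single \<alpha>)) \<and> equipotent \<beta> \<alpha>}"
    unfolding s_def by (intro ext_mk small_Collect[where a = "un \<alpha> (single \<alpha>)"] dfn_intros) auto
  have ne: "ext s \<noteq> {}" using equipotent_refl by (auto simp: s)
  have ord: "ordinal x" if "x \<in> ext s" for x using that assms ordinal_mem by (auto simp: s)
  note l = least[OF ne ord]
  have "cardinal (least s)"
    unfolding cardinal_def
  proof (intro conjI ballI notI)
    show "ordinal (least s)" using l ord by blast
    fix \<beta> assume b: "\<beta> \<in> ext (least s)" "equipotent \<beta> (least s)"
    have "\<beta> \<in> ext s"
      using b l(1) equipotent_trans ordinal_transitive[OF assms] by (auto simp: s dest: transitiveD)
    then show False using l(2) b by blast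
  qed
  then show ?thesis using l(1) by (intro that) (auto simp: s)
qed

lemma cardinal_no_inj:
  assumes "cardinal \<kappa>" "\<mu> \<in> ext \<kappa>" and f: "tm (\<lambda>e. f (e 0))"
    and im: "f ` ext \<kappa> \<subseteq> ext \<mu>" and inj: "inj_on f (ext \<kappa>)"
  shows False
proof -
  have sub: "ext \<mu> \<subseteq> ext \<kappa>"
    using assms(1,2) by (auto simp: cardinal_def ordinal_iff transitive_def)
  note f' = tm_subst1[OF f]
  define closed where "closed Y \<longleftrightarrow> (\<forall>x\<in>ext \<kappa>. x \<notin> ext \<mu> \<longrightarrow> x \<in> ext Y) \<and>
    (\<forall>x\<in>ext Y. x \<in> ext \<kappa> \<longrightarrow> f x \<in> ext Y)" for Y
  have closed': "tm t \<Longrightarrow> dfn (\<lambda>e. closed (t e))" for t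
    by (rule dfn_subst1[where Q = closed]) (auto simp: closed_def intro!: dfn_intros f')
  \<comment> \<open>Cantor--Bernstein: apply \<open>f\<close> on the closure \<open>X\<close> of \<open>\<kappa> - \<mu>\<close> under \<open>f\<close> and the identity elsewhere.\<close>
  define X where "X = mk {x. x \<in> ext \<kappa> \<and> (\<forall>Y. closed Y \<longrightarrow> x \<in> ext Y)}"
  have X: "ext X = {x. x \<in> ext \<kappa> \<and> (\<forall>Y. closed Y \<longrightarrow> x \<in> ext Y)}"
    unfolding X_def by (intro ext_mk small_Collect[where a = \<kappa>] dfn_intros closed') auto
  have X1: "x \<in> ext X" if "x \<in> ext \<kappa>" "x \<notin> ext \<mu>" for x
    using that unfolding X closed_def by blast
  have X2: "f x \<in> ext X" if "x \<in> ext X" for x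
    using that im sub unfolding X closed_def by blast
  \<comment> \<open>Were \<open>y\<close> not of the form \<open>f x\<close> with \<open>x\<close>
    in \<open>X\<close>, removing it would leave a closed set, against the minimality of
    \<open>X\<close>.\<close>
  have X3: "y \<in> f ` ext X" if y: "y \<in> ext X" "y \<in> ext \<mu>" for y
  proof (rule ccontr)
    assume n: "y \<notin> f ` ext X"
    define Y where "Y = mk {x. x \<in> ext X \<and> x \<noteq> y}"
    have Y: "ext Y = {x. x \<in> ext X \<and> x \<noteq> y}"
      unfolding Y_def by (intro ext_mk small_Collect[where a = X] dfn_intros) auto
    have "closed Y"
      unfolding closed_def Y using X1 X2 y n by auto
    then show False using y(1) Y X by blast
  qed
  define g where "g x = (if x \<in> ext X then f x else x)" for x
  have "bij_betw g (ext \<kappa>) (ext \<mu>)"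
    unfolding bij_betw_def
  proof
    show "inj_on g (ext \<kappa>)"
    proof (rule inj_onI)
      fix x y assume xy: "x \<in> ext \<kappa>" "y \<in> ext \<kappa>" "g x = g y"
      then have "x \<in> ext X \<longleftrightarrow> y \<in> ext X" using X2[of x] X2[of y] by (auto simp: g_def split: if_splits)
      then show "x = y" using xy inj by (auto simp: g_def inj_on_def split: if_splits)
    qed
    show "g ` ext \<kappa> = ext \<mu>"
    proof
      show "g ` ext \<kappa> \<subseteq> ext \<mu>" using im X1 by (auto simp: g_def)
      show "ext \<mu> \<subseteq> g ` ext \<kappa>"
      proof
        fix y assume y: "y \<in> ext \<mu>"
        show "y \<in> g ` ext \<kappa>"
        proof (cases "y \<in> ext X")
          case True
          then obtain x where "x \<in> ext X" "y = f x" using X3 y by blast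
          then show ?thesis by (intro image_eqI[of _ _ x]) (auto simp: g_def X)
        next
          case False
          then show ?thesis using y sub by (intro image_eqI[of _ _ y]) (auto simp: g_def)
        qed
      qed
    qed
  qed
  moreover have "tm (\<lambda>e. g (e 0))" unfolding g_def by (intro dfn_intros f)
  ultimately have "equipotent \<kappa> \<mu>" by (rule equipotentI[rotated])
  then show False using equipotent_sym assms(1,2) by (auto simp: cardinal_def)
qed

text \<open>As \<mu> is an ordinal, taking least preimages turns a surjection into an injection the
  other way.\<close>

lemma cardinal_no_surj:
  assumes "cardinal \<kappa>" "\<mu> \<in> ext \<kappa>" and f: "tm (\<lambda>e. f (e 0))"
    and sup: "ext \<kappa> \<subseteq> f ` ext \<mu>"
  shows False
proof -
  note f' = tm_subst1[OF f]
  define P where "P x = mk {\<xi>. \<xi> \<in> ext \<mu> \<and> f \<xi> = x}" for x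
  have P: "ext (P x) = {\<xi>. \<xi> \<in> ext \<mu> \<and> f \<xi> = x}" for x
    unfolding P_def by (intro ext_mk small_Collect[where a = \<mu>] dfn_intros f') auto
  define h where "h x = least (P x)" for x
  have "ordinal \<mu>" using assms ordinal_mem by (auto simp: cardinal_def)
  then have "h x \<in> ext (P x)" if "x \<in> ext \<kappa>" for x
    unfolding h_def using that sup ordinal_mem by (intro least(1)) (auto simp: P)
  then have h: "h x \<in> ext \<mu>" "f (h x) = x" if "x \<in> ext \<kappa>" for x
    using that by (auto simp: P)
  have "tm (\<lambda>e. h (e 0))" unfolding h_def P_def by (intro dfn_intros tm_mk f')
  then show False
    using h by (intro cardinal_no_inj[OF assms(1,2), of h] inj_onI) (auto, metis)
qed

subsection \<open>Iteration along omega and transitive closure\<close>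

definition is_succ :: "'v \<Rightarrow> 'v \<Rightarrow> bool" where
  "is_succ m n \<longleftrightarrow> ext m = insert n (ext n)"

lemma limit_succ:
  assumes "limit_ordinal w" "n \<in> ext w"
  obtains m where "m \<in> ext w" "is_succ m n"
proof -
  obtain k where k: "k \<in> ext w" "n \<in> ext k"
    using assms by (auto simp: limit_ordinal_def ext_iff) (auto simp: ext_def)
  have w: "ordinal w" using assms(1) by (simp add: limit_ordinal_def)
  have on: "ordinal n" and ok: "ordinal k" using w assms(2) k ordinal_mem by auto
  define m where "m = un n (single n)"
  have m: "ext m = insert n (ext n)" by (simp add: m_def)
  have "ordinal m"
    using on ordinal_mem[OF on] unfolding ordinal_iff[of m] transitive_def m
    by (auto simp: ordinal_iff transitive_def)
  moreover have "ext m \<subseteq> ext k" using k(2) ordinal_transitive[OF ok] by (auto simp: m transitive_def)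
  ultimately have "m = k \<or> m \<in> ext k" using ok ordinal_subset by blast
  then have "m \<in> ext w" using k(1) ordinal_transitive[OF w] by (auto simp: transitive_def)
  then show ?thesis using that m by (simp add: is_succ_def)
qed

lemma omega_cases:
  assumes "is_omega w" "m \<in> ext w"
  obtains "ext m = {}" | n where "n \<in> ext w" "is_succ m n"
proof (cases "ext m = {}")
  case False
  have w: "ordinal w" using assms(1) by (simp add: is_omega_def limit_ordinal_def)
  have om: "ordinal m" using w assms(2) by (rule ordinal_mem)
  have "\<not> limit_ordinal m" using assms by (simp add: is_omega_def)
  then obtain n where n: "n \<in> ext m" "\<And>k. k \<in> ext m \<Longrightarrow> n \<notin> ext k"
    using om False by (auto simp: limit_ordinal_def ext_def)
  have "ext m = insert n (ext n)"
    using om n transitiveD[OF ordinal_transitive[OF om] n(1)] by (auto simp: ordinal_iff)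
  then show ?thesis
    using that(2)[of n] transitiveD[OF ordinal_transitive[OF w] assms(2) n(1)] by (simp add: is_succ_def)
qed

lemma iterate:
  assumes w: "is_omega w" and G: "tm (\<lambda>e. G (e 0))"
  obtains F where "\<And>m. ext m = {} \<Longrightarrow> m \<in> ext w \<Longrightarrow> app F m = a"
    "\<And>m n. m \<in> ext w \<Longrightarrow> n \<in> ext w \<Longrightarrow> is_succ m n \<Longrightarrow> app F m = G (app F n)"
proof -
  have ow: "ordinal w" using w by (simp add: is_omega_def limit_ordinal_def)
  note G' = tm_subst1[OF G]
  \<comment> \<open>At a successor \<open>x\<close> its predecessor is \<open>union x\<close>, so
    the recursion only looks up the value there.\<close>
  define H where "H x p = (if ext x = {} then a else G (app p (union x)))" for x p
  have H: "tm (\<lambda>e. H (e 0) (e 1))" unfolding H_def by (intro dfn_intros G')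
  have R: "dfn (\<lambda>e. e 0 \<in> ext (e 1))" by (intro dfn_intros)
  show ?thesis
  proof (rule wf_recursion[OF wf_mem R H, of w], rule that)
    fix F assume F: "\<And>x. x \<in> ext w \<Longrightarrow> \<exists>p. app F x = H x p \<and>
      ext p = {q. \<exists>y\<in>ext w. y \<in> ext x \<and> q = pair y (app F y)}"
    show "app F m = a" if m: "ext m = {}" "m \<in> ext w" for m
    proof -
      obtain p where "app F m = H m p" using F[OF m(2)] by blast
      then show ?thesis using m(1) by (simp add: H_def)
    qed
    fix m n assume mn: "m \<in> ext w" "n \<in> ext w" "is_succ m n"
    obtain p where p: "app F m = H m p"
      "ext p = {q. \<exists>y\<in>ext w. y \<in> ext m \<and> q = pair y (app F y)}" using F[OF mn(1)] by blast
    have "transitive n" using ordinal_mem[OF ow mn(2)] by (rule ordinal_transitive)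
    then have "ext (union m) = ext n" using mn(3) by (auto simp: is_succ_def transitive_def)
    then have "union m = n" by (rule Extensionality)
    moreover have "app p n = app F n"
      by (rule app_eq) (use p(2) mn in \<open>auto simp: is_succ_def\<close>)
    ultimately show "app F m = G (app F n)"
      using p(1) mn(3) by (simp add: H_def is_succ_def)
  qed
qed

lemma transitive_closure:
  assumes w: "is_omega w"
  obtains T where "transitive T" "ext a \<subseteq> ext T"
proof -
  have l: "limit_ordinal w" using w by (simp add: is_omega_def)
  have "tm (\<lambda>e. union (e 0))" by (intro dfn_intros)
  from iterate[OF w this, of a] obtain F where F: "\<And>m. ext m = {} \<Longrightarrow> m \<in> ext w \<Longrightarrow> app F m = a"
    "\<And>m n. m \<in> ext w \<Longrightarrow> n \<in> ext w \<Longrightarrow> is_succ m n \<Longrightarrow> app F m = union (app F n)" by blast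
  have sm: "ext (mk (app F ` ext w)) = app F ` ext w"
    by (intro ext_mk small_image dfn_intros)
  define T where "T = union (mk (app F ` ext w))"
  have T: "ext T = (\<Union>n\<in>ext w. ext (app F n))" by (simp add: T_def sm)
  have "z \<in> ext T" if "y \<in> ext T" "z \<in> ext y" for y z
  proof -
    obtain n where n: "n \<in> ext w" "y \<in> ext (app F n)" using \<open>y \<in> ext T\<close> T by auto
    obtain m where m: "m \<in> ext w" "is_succ m n" using limit_succ[OF l n(1)] by blast
    have "z \<in> ext (app F m)" using F(2)[OF m(1) n(1) m(2)] n(2) that(2) by auto
    then show ?thesis using m(1) unfolding T by blast
  qed
  moreover obtain m where "m \<in> ext w" "ext m = {}"
    using foundation[of w] l transitiveD[of w] unfolding limit_ordinal_def ordinal_iff by blast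
  then have "ext a \<subseteq> ext T" using F(1)[of m] by (auto simp: T)
  ultimately show ?thesis by (intro that) (auto simp: transitive_def)
qed

text \<open>The collapse may identify points. This is wanted: in an ultrapower it identifies
  functions that agree almost everywhere.\<close>

lemma mostowski:
  assumes wf: "wf_on_set d R" and R: "dfn (\<lambda>e. R (e 0) (e 1))"
  obtains F where "\<And>x. x \<in> ext d \<Longrightarrow> ext (app F x) = app F ` {y \<in> ext d. R y x}"
proof -
  define H where "H x p = mk {u. \<exists>y. pair y u \<in> ext p}" for x p :: 'v
  have H: "tm (\<lambda>e. H (e 0) (e 1))" unfolding H_def by (intro dfn_intros tm_mk)
  show ?thesis
  proof (rule wf_recursion[OF wf R H], rule that)
    fix F x assume x: "x \<in> ext d" and F: "\<And>x. x \<in> ext d \<Longrightarrow> \<exists>p. app F x = H x p \<and>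
      ext p = {q. \<exists>y\<in>ext d. R y x \<and> q = pair y (app F y)}"
    obtain p where p: "app F x = H x p" "ext p = {q. \<exists>y\<in>ext d. R y x \<and> q = pair y (app F y)}"
      using F[OF x] by blast
    have eq: "{u. \<exists>y. pair y u \<in> ext p} = app F ` {y \<in> ext d. R y x}" by (auto simp: p(2))
    have "small {y. y \<in> ext d \<and> R y x}"
      by (rule small_Collect[where a = d]) (auto intro!: dfn_intros dfn_subst2[OF R])
    then obtain v where v: "ext v = {y \<in> ext d. R y x}" by (auto simp: small_def)
    have "small (app F ` ext v)" by (intro small_image dfn_intros)
    then show "ext (app F x) = app F ` {y \<in> ext d. R y x}"
      unfolding p(1) H_def eq v by (rule ext_mk)
  qed
qed

lemma dfn_is_succ [dfn_intros]: "tm s \<Longrightarrow> tm t \<Longrightarrow> dfn (\<lambda>e. is_succ (s e) (t e))"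
  by (rule dfn_subst2[where Q = is_succ])
    (auto simp: is_succ_def set_eq_iff intro!: dfn_intros)

end

section \<open>Ultrapowers by a measure\<close>

text \<open>Fixing omega below \<delta> turns \<delta>-completeness into countable completeness, the
  source of wellfoundedness of the ultrapowers.\<close>

locale measure_on = ZFC_structure mem
  for mem :: "'v \<Rightarrow> 'v \<Rightarrow> bool"  (infix "\<^bold>\<in>" 50) +
  fixes w \<delta> U :: 'v
  assumes omega: "is_omega w" "w \<in> ext \<delta>"
    and ultrafilter: "ultrafilter_on U \<delta>"
    and nonprincipal: "nonprincipal U \<delta>"
    and complete: "complete_filter \<delta> U \<delta>"
begin

section \<open>The measure and the quantifier almost everywhere\<close>

lemma measure_one:
  "s \<in> ext U \<Longrightarrow> ext s \<subseteq> ext \<delta>" "s \<in> ext U \<Longrightarrow> ext s \<noteq> {}" "\<delta> \<in> ext U"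
  "s \<in> ext U \<Longrightarrow> ext s \<subseteq> ext t \<Longrightarrow> ext t \<subseteq> ext \<delta> \<Longrightarrow> t \<in> ext U"
  "s \<in> ext U \<Longrightarrow> t \<in> ext U \<Longrightarrow> \<exists>u\<in>ext U. ext u = ext s \<inter> ext t"
  "ext s \<subseteq> ext \<delta> \<Longrightarrow> s \<notin> ext U \<Longrightarrow> \<exists>t\<in>ext U. ext t = ext \<delta> - ext s"
proof -
  note * = ultrafilter[unfolded ultrafilter_on_def]
  have "\<forall>s\<in>ext U. ext s \<subseteq> ext \<delta> \<and> ext s \<noteq> {}" using * by (elim conjE)
  then show "s \<in> ext U \<Longrightarrow> ext s \<subseteq> ext \<delta>" "s \<in> ext U \<Longrightarrow> ext s \<noteq> {}" by blast+
  have "\<delta> \<^bold>\<in> U" using * by (elim conjE)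
  then show "\<delta> \<in> ext U" by (rule ext_iff[THEN iffD2])
  have "\<forall>s\<in>ext U. \<forall>t. ext s \<subseteq> ext t \<longrightarrow> ext t \<subseteq> ext \<delta> \<longrightarrow> t \<^bold>\<in> U" using * by (elim conjE)
  then show "s \<in> ext U \<Longrightarrow> ext s \<subseteq> ext t \<Longrightarrow> ext t \<subseteq> ext \<delta> \<Longrightarrow> t \<in> ext U"
    unfolding ext_iff[of t U] by blast
  have "\<forall>s\<in>ext U. \<forall>t\<in>ext U. \<exists>u\<in>ext U. ext u = ext s \<inter> ext t" using * by (elim conjE)
  then show "s \<in> ext U \<Longrightarrow> t \<in> ext U \<Longrightarrow> \<exists>u\<in>ext U. ext u = ext s \<inter> ext t" by blast
  have "\<forall>s. ext s \<subseteq> ext \<delta> \<longrightarrow> s \<^bold>\<in> U \<or> (\<exists>t\<in>ext U. ext t = ext \<delta> - ext s)" using * by (elim conjE)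
  then show "ext s \<subseteq> ext \<delta> \<Longrightarrow> s \<notin> ext U \<Longrightarrow> \<exists>t\<in>ext U. ext t = ext \<delta> - ext s"
    unfolding ext_iff[of s U] by blast
qed

text \<open>The measure as a HOL filter, which gives access to the calculus of
  \<open>eventually\<close>. The ultrafilter property concerns sets of the model, so deciding a
  predicate requires its definability.\<close>

definition uf :: "'v filter" where
  "uf = Abs_filter (\<lambda>Q. \<exists>s\<in>ext U. \<forall>i\<in>ext s. Q i)"

lemma eventually_uf: "eventually Q uf \<longleftrightarrow> (\<exists>s\<in>ext U. \<forall>i\<in>ext s. Q i)"
  unfolding uf_def
proof (rule eventually_Abs_filter, unfold_locales)
  show "\<exists>s\<in>ext U. \<forall>i\<in>ext s. True" using measure_one(3) by blast
next
  fix P Q assume "\<exists>s\<in>ext U. \<forall>i\<in>ext s. P i" "\<exists>s\<in>ext U. \<forall>i\<in>ext s. Q i"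
  then obtain s t where "s \<in> ext U" "t \<in> ext U" "\<forall>i\<in>ext s. P i" "\<forall>i\<in>ext t. Q i" by blast
  moreover from this obtain u where "u \<in> ext U" "ext u = ext s \<inter> ext t"
    using measure_one(5) by blast
  ultimately show "\<exists>s\<in>ext U. \<forall>i\<in>ext s. P i \<and> Q i" by blast
qed blast

lemma eventually_dom: "eventually (\<lambda>i. i \<in> ext \<delta>) uf"
  unfolding eventually_uf using measure_one(3) by blast

lemma eventually_domI: "(\<And>i. i \<in> ext \<delta> \<Longrightarrow> Q i) \<Longrightarrow> eventually Q uf"
  using eventually_dom by (rule eventually_mono)

lemma not_eventually_False [simp]: "\<not> eventually (\<lambda>_. False) uf"
  unfolding eventually_uf using measure_one(2) by blast

lemma eventually_uf_ex: "eventually Q uf \<Longrightarrow> \<exists>i\<in>ext \<delta>. Q i"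
proof (rule ccontr)
  assume "eventually Q uf" "\<not> (\<exists>i\<in>ext \<delta>. Q i)"
  then have "eventually (\<lambda>_. False) uf"
    using eventually_mono[OF eventually_conj[OF eventually_dom, of Q], of "\<lambda>_. False"] by blast
  then show False by simp
qed

lemma eventually_set:
  assumes "ext s \<subseteq> ext \<delta>"
  shows "eventually (\<lambda>i. i \<in> ext s) uf \<longleftrightarrow> s \<in> ext U"
proof
  assume "eventually (\<lambda>i. i \<in> ext s) uf"
  then obtain t where "t \<in> ext U" "ext t \<subseteq> ext s" unfolding eventually_uf by blast
  then show "s \<in> ext U" using measure_one(4) assms by blast
qed (auto simp: eventually_uf)

lemma eventually_not:
  assumes Q: "dfn (\<lambda>e. Q (e 0))"
  shows "eventually (\<lambda>i. \<not> Q i) uf \<longleftrightarrow> \<not> eventually Q uf"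
proof
  assume *: "eventually (\<lambda>i. \<not> Q i) uf"
  show "\<not> eventually Q uf"
  proof
    assume "eventually Q uf"
    with * have "eventually (\<lambda>_. False) uf" by eventually_elim simp
    then show False by simp
  qed
next
  assume n: "\<not> eventually Q uf"
  define s where "s = mk {i. i \<in> ext \<delta> \<and> Q i}"
  have s: "ext s = {i. i \<in> ext \<delta> \<and> Q i}"
    unfolding s_def by (intro ext_mk small_Collect[where a = \<delta>] dfn_intros Q) auto
  have "s \<notin> ext U" using n s unfolding eventually_uf by blast
  moreover have "ext s \<subseteq> ext \<delta>" using s by blast
  ultimately obtain t where "t \<in> ext U" "ext t = ext \<delta> - ext s"
    using measure_one(6) by blast
  then show "eventually (\<lambda>i. \<not> Q i) uf" unfolding eventually_uf using s by blast
qed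

lemma eventually_or:
  assumes Q: "dfn (\<lambda>e. Q (e 0))" and "eventually (\<lambda>i. Q i \<or> R i) uf"
  shows "eventually Q uf \<or> eventually R uf"
proof (cases "eventually Q uf")
  case False
  then have "eventually (\<lambda>i. \<not> Q i) uf" by (simp add: eventually_not Q)
  with assms(2) have "eventually R uf" by eventually_elim simp
  then show ?thesis ..
qed simp

lemma dfn_eventually [dfn_intros]:
  assumes "dfn (\<lambda>e. Q (e 0) (\<lambda>i. e (Suc i)))"
  shows "dfn (\<lambda>e. eventually (\<lambda>i. Q i e) uf)"
proof -
  have "dfn (\<lambda>e. Q (e 0) (\<lambda>i. e (Suc (Suc i))))"
    using dfn_inj[OF assms, of "case_nat 0 (\<lambda>i. Suc (Suc i))"]
    by (auto simp: inj_def split: nat.splits)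
  then show ?thesis unfolding eventually_uf by (intro dfn_intros)
qed

text \<open>Replacement gathers the measure one sets \<open>A \<xi>\<close> into a sequence of the
  model, to which completeness applies.\<close>

lemma eventually_family:
  assumes Q: "dfn (\<lambda>e. Q (e 0) (e 1))" and "\<gamma> \<in> ext \<delta>"
    and ev: "\<And>\<xi>. \<xi> \<in> ext \<gamma> \<Longrightarrow> eventually (Q \<xi>) uf"
  shows "eventually (\<lambda>i. \<forall>\<xi>\<in>ext \<gamma>. Q \<xi> i) uf"
proof -
  note Q' = dfn_subst2[OF Q]
  define A where "A \<xi> = mk {i. i \<in> ext \<delta> \<and> Q \<xi> i}" for \<xi>
  have A: "ext (A \<xi>) = {i. i \<in> ext \<delta> \<and> Q \<xi> i}" for \<xi>
    unfolding A_def by (intro ext_mk small_Collect[where a = \<delta>] dfn_intros Q') auto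
  have tA: "tm (\<lambda>e. A (e 0))" unfolding A_def by (intro tm_mk dfn_intros Q')
  have "eventually (\<lambda>i. i \<in> ext (A \<xi>)) uf" if "\<xi> \<in> ext \<gamma>" for \<xi>
    using eventually_conj[OF eventually_dom ev[OF that]] by (simp add: A)
  then have AU: "A \<xi> \<in> ext U" if "\<xi> \<in> ext \<gamma>" for \<xi>
    using that eventually_set[of "A \<xi>"] by (auto simp: A)
  have f: "is_fun (lam \<gamma> A) \<gamma> U" by (intro is_fun_lam tA AU)
  with complete assms(2) obtain t where t: "t \<in> ext U"
    "ext t = {x \<in> ext \<delta>. \<forall>\<xi> s. rel (lam \<gamma> A) \<xi> s \<longrightarrow> x \<^bold>\<in> s}"
    unfolding complete_filter_def by blast
  have "\<forall>\<xi>\<in>ext \<gamma>. Q \<xi> i" if "i \<in> ext t" for i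
  proof
    fix \<xi> assume x: "\<xi> \<in> ext \<gamma>"
    then have "rel (lam \<gamma> A) \<xi> (A \<xi>)" using is_fun_rel[OF f] by (simp add: app_lam tA)
    then have "i \<in> ext (A \<xi>)" using that unfolding t(2) by (auto simp: ext_iff)
    then show "Q \<xi> i" by (simp add: A)
  qed
  then show ?thesis unfolding eventually_uf using t(1) by blast
qed

text \<open>If the singleton of \<open>a\<close> had measure one, it would generate
  \<open>U\<close>, making it principal.\<close>

lemma not_eventually_eq: "\<not> eventually (\<lambda>i. i = a) uf"
proof
  assume *: "eventually (\<lambda>i. i = a) uf"
  have "ext U = {s. ext (single a) \<subseteq> ext s \<and> ext s \<subseteq> ext \<delta>}"
  proof (intro set_eqI iffI)
    fix s assume s: "s \<in> ext U"
    then have "eventually (\<lambda>i. i \<in> ext s) uf" unfolding eventually_uf by blast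
    from eventually_uf_ex[OF eventually_conj[OF * this]] have "a \<in> ext s" by blast
    then show "s \<in> {s. ext (single a) \<subseteq> ext s \<and> ext s \<subseteq> ext \<delta>}"
      using measure_one(1)[OF s] by simp
  next
    fix s assume "s \<in> {s. ext (single a) \<subseteq> ext s \<and> ext s \<subseteq> ext \<delta>}"
    then show "s \<in> ext U" using eventually_mono[OF *, of "\<lambda>i. i \<in> ext s"] eventually_set[of s] by auto
  qed
  then show False using nonprincipal unfolding nonprincipal_def by blast
qed

lemma eventually_choice:
  assumes R: "dfn (\<lambda>e. R (e 0) (e 1))" and ev: "eventually (\<lambda>i. \<exists>x\<in>ext T. R i x) uf"
  obtains k where "is_fun k \<delta> T" "eventually (\<lambda>i. R i (app k i)) uf"
proof -
  note R' = dfn_subst2[OF R]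
  have ne: "\<exists>x. x \<in> ext T" using eventually_uf_ex[OF ev] by blast
  \<comment> \<open>\<open>choice_fun\<close> demands a value at every coordinate; the implication
    admits an arbitrary element of \<open>T\<close> where there is no witness.\<close>
  have "dfn (\<lambda>e. (\<exists>x\<in>ext T. R (e 0) x) \<longrightarrow> R (e 0) (e 1))" by (intro dfn_intros R')
  then obtain k where k: "is_fun k \<delta> T" "\<And>i. i \<in> ext \<delta> \<Longrightarrow> (\<exists>x\<in>ext T. R i x) \<longrightarrow> R i (app k i)"
    by (rule choice_fun) (use ne in blast)+
  have "eventually (\<lambda>i. R i (app k i)) uf"
    using ev eventually_dom by eventually_elim (use k(2) in blast)
  with k(1) show ?thesis by (rule that)
qed

subsection \<open>The collapsed ultrapower of a transitive set\<close>

definition E :: "'v \<Rightarrow> 'v \<Rightarrow> bool" where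
  "E f g \<longleftrightarrow> eventually (\<lambda>i. app f i \<in> ext (app g i)) uf"

lemma dfn_E [dfn_intros]: "tm s \<Longrightarrow> tm t \<Longrightarrow> dfn (\<lambda>e. E (s e) (t e))"
  by (rule dfn_subst2[where Q = E]) (auto simp: E_def intro!: dfn_intros)

text \<open>From a set without minimal element, choice and iteration produce a descending sequence
  of length omega. By countable completeness it descends at one common coordinate, against
  Foundation.\<close>

lemma wf_E: "wf_on_set d E"
  unfolding wf_on_set_def
proof (intro allI impI, rule ccontr)
  fix s assume "ext s \<subseteq> ext d" "ext s \<noteq> {}"
    and n: "\<not> (\<exists>m\<in>ext s. \<forall>y\<in>ext s. \<not> E y m)"
  then obtain f0 where f0: "f0 \<in> ext s" by blast
  have "dfn (\<lambda>e. E (e 1) (e 0))" by (intro dfn_intros)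
  then obtain c where c: "is_fun c s s" "\<And>f. f \<in> ext s \<Longrightarrow> E (app c f) f"
    by (rule choice_fun[of "\<lambda>x y. E y x" s s]) (use n in blast)+
  have "tm (\<lambda>e. app c (e 0))" by (intro dfn_intros)
  then obtain F where F: "\<And>m. ext m = {} \<Longrightarrow> m \<in> ext w \<Longrightarrow> app F m = f0"
    "\<And>m n. m \<in> ext w \<Longrightarrow> n \<in> ext w \<Longrightarrow> is_succ m n \<Longrightarrow> app F m = app c (app F n)"
    by (rule iterate[OF omega(1)]) blast
  have Fs: "app F n \<in> ext s" if "n \<in> ext w" for n
    using that
  proof (induction rule: wf_on_set_induct[where R = "\<lambda>x y. x \<in> ext y"])
    case wf
    show ?case by (rule wf_mem)
  next
    case dfn
    show ?case by (intro dfn_intros)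
  next
    case (step m)
    show ?case
    proof (rule omega_cases[OF omega(1) step(1)])
      assume "ext m = {}"
      then show ?thesis using F(1) step(1) f0 by simp
    next
      fix n assume n: "n \<in> ext w" "is_succ m n"
      then have "app F n \<in> ext s" using step(2) by (auto simp: is_succ_def)
      then show ?thesis using F(2)[OF step(1) n] is_fun_app[OF c(1)] by simp
    qed
  qed
  define Q where "Q n i \<longleftrightarrow> (\<forall>m\<in>ext w. is_succ m n \<longrightarrow> app (app F m) i \<in> ext (app (app F n) i))" for n i
  have "dfn (\<lambda>e. Q (e 0) (e 1))" unfolding Q_def by (intro dfn_intros)
  moreover have "eventually (Q n) uf" if n: "n \<in> ext w" for n
  proof -
    have "limit_ordinal w" using omega(1) by (simp add: is_omega_def)
    then obtain m where m: "m \<in> ext w" "is_succ m n" using n by (rule limit_succ)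
    have uniq: "m' = m" if "is_succ m' n" for m'
      using that m(2) by (auto simp: is_succ_def intro: Extensionality)
    have "E (app F m) (app F n)" using F(2)[OF m(1) n m(2)] c(2)[OF Fs[OF n]] by simp
    then show ?thesis unfolding E_def Q_def by eventually_elim (use uniq in blast)
  qed
  ultimately have "eventually (\<lambda>i. \<forall>n\<in>ext w. Q n i) uf" by (rule eventually_family[OF _ omega(2)])
  then obtain i where i: "\<And>n. n \<in> ext w \<Longrightarrow> Q n i" using eventually_uf_ex by blast
  have "tm (\<lambda>e. app (app F (e 0)) i)" by (intro dfn_intros)
  then have sm: "small ((\<lambda>n. app (app F n) i) ` ext w)" by (rule small_image)
  have "w \<noteq> emp" using omega(1) by (auto simp: is_omega_def limit_ordinal_def)
  then have "ext w \<noteq> {}" using ext_emp Extensionality by metis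
  then obtain n where n: "n \<in> ext w" "\<And>m. m \<in> ext w \<Longrightarrow> app (app F m) i \<notin> ext (app (app F n) i)"
    using foundation[of "mk ((\<lambda>n. app (app F n) i) ` ext w)"] unfolding ext_mk[OF sm] by auto
  have "limit_ordinal w" using omega(1) by (simp add: is_omega_def)
  then obtain m where "m \<in> ext w" "is_succ m n" using n(1) by (rule limit_succ)
  then show False using i[OF n(1)] n(2) unfolding Q_def by blast
qed

text \<open>HOL's choice picks one collapsing map for each \<open>T\<close>. With \<open>T\<close>
  fixed this map is a single element, hence a parameter, so \<open>cl T\<close> is a term in its
  other argument.\<close>

definition col :: "'v \<Rightarrow> 'v" where
  "col T = (SOME F. \<forall>x\<in>ext (funs \<delta> T). ext (app F x) = app F ` {y \<in> ext (funs \<delta> T). E y x})"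

definition cl :: "'v \<Rightarrow> 'v \<Rightarrow> 'v" where
  "cl T f = app (col T) f"

lemma tm_cl [dfn_intros]: "tm t \<Longrightarrow> tm (\<lambda>e. cl T (t e))"
  unfolding cl_def by (intro dfn_intros)

lemma ext_cl:
  assumes "is_fun g \<delta> T"
  shows "ext (cl T g) = cl T ` {f. is_fun f \<delta> T \<and> E f g}"
proof -
  have "\<exists>F. \<forall>x\<in>ext (funs \<delta> T). ext (app F x) = app F ` {y \<in> ext (funs \<delta> T). E y x}"
    by (rule mostowski[OF wf_E, of "funs \<delta> T"]) (auto intro: dfn_intros)
  from someI_ex[OF this] show ?thesis
    using assms unfolding cl_def[abs_def] col_def by simp
qed

lemma fun_induct [consumes 1, case_names dfn step]:
  assumes "is_fun f \<delta> T" "dfn (\<lambda>e. Q (e 0))"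
    and "\<And>f. is_fun f \<delta> T \<Longrightarrow> (\<And>g. is_fun g \<delta> T \<Longrightarrow> E g f \<Longrightarrow> Q g) \<Longrightarrow> Q f"
  shows "Q f"
proof (rule wf_on_set_induct[of f "funs \<delta> T" E])
  show "f \<in> ext (funs \<delta> T)" using assms(1) by simp
qed (use assms(3) in \<open>auto intro: wf_E assms(2)\<close>)

lemma cl_eqI:
  assumes "is_fun f \<delta> T" "is_fun g \<delta> T" "eventually (\<lambda>i. app f i = app g i) uf"
  shows "cl T f = cl T g"
proof (rule Extensionality)
  have "E h f \<longleftrightarrow> E h g" for h
    unfolding E_def by (rule eventually_subst) (use assms(3) in \<open>eventually_elim, simp\<close>)
  then show "ext (cl T f) = ext (cl T g)" using assms by (simp add: ext_cl)
qed

text \<open>Transitivity of \<open>T\<close> places the witnesses found below \<open>app g i\<close>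
  in \<open>T\<close>, where choice assembles them into one function.\<close>

lemma E_funE:
  assumes "transitive T" "is_fun g \<delta> T" "dfn (\<lambda>e. R (e 0) (e 1))"
    and "eventually (\<lambda>i. \<exists>x\<in>ext (app g i). R i x) uf"
  obtains k where "is_fun k \<delta> T" "E k g" "eventually (\<lambda>i. R i (app k i)) uf"
proof -
  have "dfn (\<lambda>e. e 1 \<in> ext (app g (e 0)) \<and> R (e 0) (e 1))"
    by (intro dfn_intros assms(3))
  moreover have "eventually (\<lambda>i. \<exists>x\<in>ext T. x \<in> ext (app g i) \<and> R i x) uf"
    using assms(4) eventually_dom
    by eventually_elim (use is_fun_app[OF assms(2)] assms(1) in \<open>auto simp: transitive_def\<close>)
  ultimately obtain k where k: "is_fun k \<delta> T" "eventually (\<lambda>i. app k i \<in> ext (app g i) \<and> R i (app k i)) uf"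
    by (rule eventually_choice)
  show ?thesis
    using k by (intro that[of k]) (auto simp: E_def elim: eventually_mono)
qed

text \<open>Induction on \<open>f\<close>. If \<open>f\<close> and \<open>g\<close> differ almost
  everywhere, then almost everywhere one fixed side has an element missing from the other, and
  \<open>E_funE\<close> yields such a \<open>k\<close>. As the collapses are equal,
  \<open>cl T k\<close> is also the collapse of some \<open>k'\<close> on the other side; the
  induction hypothesis makes \<open>k\<close> and \<open>k'\<close> agree almost everywhere, a
  contradiction.\<close>

lemma cl_eq_iff:
  assumes T: "transitive T" and f: "is_fun f \<delta> T" and g: "is_fun g \<delta> T"
  shows "cl T f = cl T g \<longleftrightarrow> eventually (\<lambda>i. app f i = app g i) uf"
proof
  define Q where "Q f \<longleftrightarrow> (\<forall>g. is_fun g \<delta> T \<longrightarrow> cl T f = cl T g \<longrightarrow> eventually (\<lambda>i. app f i = app g i) uf)" for f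
  have "Q f" using f
  proof (induction rule: fun_induct)
    case dfn
    show ?case unfolding Q_def by (intro dfn_intros)
  next
    case (step f)
    show ?case unfolding Q_def
    proof (intro allI impI, rule ccontr)
      fix g assume g: "is_fun g \<delta> T" and eq: "cl T f = cl T g"
        and "\<not> eventually (\<lambda>i. app f i = app g i) uf"
      moreover have "dfn (\<lambda>e. app f (e 0) = app g (e 0))" by (intro dfn_intros)
      ultimately have "eventually (\<lambda>i. app f i \<noteq> app g i) uf" by (simp add: eventually_not)
      then have *: "eventually (\<lambda>i. (\<exists>x\<in>ext (app f i). x \<notin> ext (app g i)) \<or>
        (\<exists>x\<in>ext (app g i). x \<notin> ext (app f i))) uf"
        by eventually_elim (use Extensionality in blast)
      have "eventually (\<lambda>i. \<exists>x\<in>ext (app f i). x \<notin> ext (app g i)) uf \<or>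
        eventually (\<lambda>i. \<exists>x\<in>ext (app g i). x \<notin> ext (app f i)) uf"
        by (rule eventually_or[OF _ *]) (intro dfn_intros)
      then show False
      proof
        assume ev: "eventually (\<lambda>i. \<exists>x\<in>ext (app f i). x \<notin> ext (app g i)) uf"
        have "dfn (\<lambda>e. e 1 \<notin> ext (app g (e 0)))" by (intro dfn_intros)
        from E_funE[OF T step(1) this ev]
        obtain k where k: "is_fun k \<delta> T" "E k f" "eventually (\<lambda>i. app k i \<notin> ext (app g i)) uf" by blast
        then have "cl T k \<in> ext (cl T g)" using ext_cl[OF step(1)] eq by auto
        then obtain k' where k': "is_fun k' \<delta> T" "E k' g" "cl T k = cl T k'"
          using ext_cl[OF g] by auto
        have "eventually (\<lambda>i. app k i = app k' i) uf"
          using step(2)[OF k(1,2)] k' by (auto simp: Q_def)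
        with k(3) k'(2)[unfolded E_def] have "eventually (\<lambda>_. False) uf" by eventually_elim simp
        then show False by simp
      next
        assume ev: "eventually (\<lambda>i. \<exists>x\<in>ext (app g i). x \<notin> ext (app f i)) uf"
        have "dfn (\<lambda>e. e 1 \<notin> ext (app f (e 0)))" by (intro dfn_intros)
        from E_funE[OF T g this ev]
        obtain k where k: "is_fun k \<delta> T" "E k g" "eventually (\<lambda>i. app k i \<notin> ext (app f i)) uf" by blast
        then have "cl T k \<in> ext (cl T f)" using ext_cl[OF g] eq by auto
        then obtain k' where k': "is_fun k' \<delta> T" "E k' f" "cl T k = cl T k'"
          using ext_cl[OF step(1)] by auto
        have "eventually (\<lambda>i. app k' i = app k i) uf"
          using step(2)[OF k'(1,2)] k(1) k'(3) by (auto simp: Q_def)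
        with k(3) k'(2)[unfolded E_def] have "eventually (\<lambda>_. False) uf" by eventually_elim simp
        then show False by simp
      qed
    qed
  qed
  then show "cl T f = cl T g \<Longrightarrow> eventually (\<lambda>i. app f i = app g i) uf"
    using g by (auto simp: Q_def)
qed (rule cl_eqI[OF f g])

lemma cl_mem_iff:
  assumes T: "transitive T" and f: "is_fun f \<delta> T" and g: "is_fun g \<delta> T"
  shows "cl T f \<in> ext (cl T g) \<longleftrightarrow> E f g"
proof
  assume "cl T f \<in> ext (cl T g)"
  then obtain k where k: "is_fun k \<delta> T" "E k g" "cl T f = cl T k" using ext_cl[OF g] by auto
  then have "eventually (\<lambda>i. app f i = app k i) uf" using cl_eq_iff[OF T f] by simp
  with k(2) show "E f g" unfolding E_def by eventually_elim simp
qed (use f ext_cl[OF g] in auto)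

lemma cl_memE:
  assumes "is_fun g \<delta> T" "x \<in> ext (cl T g)"
  obtains f where "is_fun f \<delta> T" "E f g" "x = cl T f"
  using assms ext_cl by auto

text \<open>Truth on both sides is evaluated in the whole model. A bounded quantifier ranges over
  members of a collapsed value, and these are collapses of functions into \<open>T\<close>;
  conversely \<open>E_funE\<close> glues witnesses found at the coordinates.\<close>

theorem Los_Delta0:
  assumes T: "transitive T" and "Delta0 \<phi>" "\<And>n. is_fun (e n) \<delta> T"
  shows "sat (\<lambda>n. cl T (e n)) \<phi> \<longleftrightarrow> eventually (\<lambda>i. sat (\<lambda>n. app (e n) i) \<phi>) uf"
  using assms(2,3)
proof (induction arbitrary: e)
  case (1 i j)
  have "sat (\<lambda>n. cl T (e n)) (FMem i j) \<longleftrightarrow> cl T (e i) \<in> ext (cl T (e j))" by (simp add: ext_iff)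
  also have "\<dots> \<longleftrightarrow> E (e i) (e j)" using 1 by (intro cl_mem_iff[OF T])
  finally show ?case by (simp add: E_def ext_iff)
next
  case (2 i j)
  then show ?case using cl_eq_iff[OF T] by simp
next
  case (3 \<phi>)
  have "dfn (\<lambda>x. sat (\<lambda>n. app (e n) (x 0)) \<phi>)" by (intro dfn_sat dfn_intros)
  then show ?case using 3 by (simp add: eventually_not)
next
  case (4 \<phi> \<psi>)
  then show ?case by (simp add: eventually_conj_iff)
next
  case (5 k j \<phi>)
  have upd: "(\<lambda>n. cl T (e n))(k := cl T f) = (\<lambda>n. cl T ((e(k := f)) n))" for f by auto
  have upd': "(\<lambda>n. app (e n) i)(k := app f i) = (\<lambda>n. app ((e(k := f)) n) i)" for f i by auto
  have IH: "sat ((\<lambda>n. cl T (e n))(k := cl T f)) \<phi> \<longleftrightarrow>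
      eventually (\<lambda>i. sat ((\<lambda>n. app (e n) i)(k := app f i)) \<phi>) uf" if "is_fun f \<delta> T" for f
    unfolding upd upd' by (rule 5(3)) (use that 5 in auto)
  have "sat (\<lambda>n. cl T (e n)) (FEx k (FAnd (FMem k j) \<phi>)) \<longleftrightarrow>
      (\<exists>x\<in>ext (cl T (e j)). sat ((\<lambda>n. cl T (e n))(k := x)) \<phi>)"
    using 5(1) by (auto simp: ext_iff)
  also have "\<dots> \<longleftrightarrow> (\<exists>f. is_fun f \<delta> T \<and> E f (e j) \<and>
      eventually (\<lambda>i. sat ((\<lambda>n. app (e n) i)(k := app f i)) \<phi>) uf)"
    unfolding ext_cl[OF 5(4)] using IH by auto
  also have "\<dots> \<longleftrightarrow> eventually (\<lambda>i. \<exists>x\<in>ext (app (e j) i). sat ((\<lambda>n. app (e n) i)(k := x)) \<phi>) uf"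
  proof
    assume "\<exists>f. is_fun f \<delta> T \<and> E f (e j) \<and>
      eventually (\<lambda>i. sat ((\<lambda>n. app (e n) i)(k := app f i)) \<phi>) uf"
    then obtain f where "E f (e j)" "eventually (\<lambda>i. sat ((\<lambda>n. app (e n) i)(k := app f i)) \<phi>) uf"
      by blast
    then show "eventually (\<lambda>i. \<exists>x\<in>ext (app (e j) i). sat ((\<lambda>n. app (e n) i)(k := x)) \<phi>) uf"
      unfolding E_def by eventually_elim blast
  next
    assume ev: "eventually (\<lambda>i. \<exists>x\<in>ext (app (e j) i). sat ((\<lambda>n. app (e n) i)(k := x)) \<phi>) uf"
    have "dfn (\<lambda>x. sat (\<lambda>n. if n = k then x 1 else app (e n) (x 0)) \<phi>)"
    proof (rule dfn_sat)
      show "tm (\<lambda>x. if n = k then x 1 else app (e n) (x 0))" for n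
        by (cases "n = k") (simp_all add: tm_var tm_app tm_const)
    qed
    then have "dfn (\<lambda>x. sat ((\<lambda>n. app (e n) (x 0))(k := x 1)) \<phi>)" by (simp only: fun_upd_def)
    from E_funE[OF T 5(4) this ev]
    show "\<exists>f. is_fun f \<delta> T \<and> E f (e j) \<and>
      eventually (\<lambda>i. sat ((\<lambda>n. app (e n) i)(k := app f i)) \<phi>) uf" by blast
  qed
  also have "\<dots> \<longleftrightarrow> eventually (\<lambda>i. sat (\<lambda>n. app (e n) i) (FEx k (FAnd (FMem k j) \<phi>))) uf"
    using 5(1) by (intro arg_cong[of _ _ "\<lambda>Q. eventually Q uf"]) (auto simp: ext_iff fun_eq_iff)
  finally show ?case .
qed

text \<open>A function into \<open>T'\<close> that is below \<open>f\<close> takes values in the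
  transitive set \<open>T\<close> almost everywhere, so changing it on a null set gives a function
  into \<open>T\<close> with the same collapse.\<close>

lemma cl_extend:
  assumes "transitive T" "transitive T'" "ext T \<subseteq> ext T'" "is_fun f \<delta> T"
  shows "cl T f = cl T' f"
  using assms(4)
proof (induction rule: fun_induct)
  case dfn
  show ?case by (intro dfn_intros)
next
  case (step f)
  have up: "is_fun g \<delta> T'" if "is_fun g \<delta> T" for g
    using that is_fun_app[OF that] assms(3) by (intro is_fun_mono[OF that]) auto
  show ?case
  proof (rule Extensionality, intro set_eqI iffI)
    fix x assume "x \<in> ext (cl T f)"
    then obtain g where g: "is_fun g \<delta> T" "E g f" "x = cl T g" using cl_memE[OF step(1)] by blast
    then show "x \<in> ext (cl T' f)"
      using step(2)[OF g(1,2)] up[OF g(1)] ext_cl[OF up[OF step(1)]] by auto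
  next
    fix x assume "x \<in> ext (cl T' f)"
    then obtain g where g: "is_fun g \<delta> T'" "E g f" "x = cl T' g"
      using cl_memE[OF up[OF step(1)]] by blast
    have "dfn (\<lambda>e. e 1 = app g (e 0))" by (intro dfn_intros)
    moreover have "eventually (\<lambda>i. \<exists>x\<in>ext (app f i). x = app g i) uf"
      using g(2) unfolding E_def by eventually_elim blast
    ultimately obtain h where h: "is_fun h \<delta> T" "E h f" "eventually (\<lambda>i. app h i = app g i) uf"
      by (rule E_funE[OF assms(1) step(1)])
    have "cl T' h = cl T' g" using h(3) by (intro cl_eqI up h(1) g(1))
    then have "x = cl T h" using step(2)[OF h(1,2)] g(3) by simp
    then show "x \<in> ext (cl T f)" using cl_mem_iff[OF assms(1) h(1) step(1)] h(2) by simp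
  qed
qed

subsection \<open>The ultrapower embedding\<close>

definition cst :: "'v \<Rightarrow> 'v" where
  "cst a = lam \<delta> (\<lambda>_. a)"

definition j :: "'v \<Rightarrow> 'v \<Rightarrow> 'v" where
  "j T a = cl T (cst a)"

lemma tm_cst [dfn_intros]: "tm t \<Longrightarrow> tm (\<lambda>e. cst (t e))"
  by (rule tm_subst1[where f = cst]) (auto simp: cst_def intro!: dfn_intros)

lemma tm_j [dfn_intros]: "tm t \<Longrightarrow> tm (\<lambda>e. j T (t e))"
  unfolding j_def by (intro dfn_intros)

lemma app_cst: "i \<in> ext \<delta> \<Longrightarrow> app (cst a) i = a"
  unfolding cst_def by (intro app_lam dfn_intros)

lemma is_fun_cst: "a \<in> ext T \<Longrightarrow> is_fun (cst a) \<delta> T"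
  unfolding cst_def by (intro is_fun_lam dfn_intros)

lemma E_cst: "E f (cst a) \<longleftrightarrow> eventually (\<lambda>i. app f i \<in> ext a) uf"
  unfolding E_def
  by (rule eventually_subst, rule eventually_mono[OF eventually_dom]) (simp add: app_cst)

lemma eventually_uf_const [simp]: "eventually (\<lambda>_. P) uf \<longleftrightarrow> P"
  by (cases P) simp_all

lemma cl_mem_j:
  assumes "transitive T" "is_fun f \<delta> T" "a \<in> ext T"
  shows "cl T f \<in> ext (j T a) \<longleftrightarrow> eventually (\<lambda>i. app f i \<in> ext a) uf"
  unfolding j_def cl_mem_iff[OF assms(1,2) is_fun_cst[OF assms(3)]] by (rule E_cst)

lemma cl_eq_j:
  assumes "transitive T" "is_fun f \<delta> T" "a \<in> ext T"
  shows "cl T f = j T a \<longleftrightarrow> eventually (\<lambda>i. app f i = a) uf"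
  unfolding j_def cl_eq_iff[OF assms(1,2) is_fun_cst[OF assms(3)]]
  by (rule eventually_subst, rule eventually_mono[OF eventually_dom]) (simp add: app_cst)

lemma j_mem_iff:
  assumes "transitive T" "a \<in> ext T" "b \<in> ext T"
  shows "j T a \<in> ext (j T b) \<longleftrightarrow> a \<in> ext b"
proof -
  have "eventually (\<lambda>i. app (cst a) i \<in> ext b) uf \<longleftrightarrow> eventually (\<lambda>i. a \<in> ext b) uf"
    by (rule eventually_subst, rule eventually_mono[OF eventually_dom]) (simp add: app_cst)
  then show ?thesis
    using cl_mem_j[OF assms(1) is_fun_cst[OF assms(2)] assms(3)] by (simp flip: j_def)
qed

text \<open>A representing function has its values in \<open>a\<close> almost everywhere; a change
  on a null set moves all of them into \<open>a\<close>.\<close>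

lemma j_memE:
  assumes "transitive T" "a \<in> ext T" "x \<in> ext (j T a)"
  obtains f where "is_fun f \<delta> a" "is_fun f \<delta> T" "x = cl T f"
proof -
  obtain f where f: "is_fun f \<delta> T" "E f (cst a)" "x = cl T f"
    using cl_memE[OF is_fun_cst[OF assms(2)]] assms(3) unfolding j_def by blast
  have "dfn (\<lambda>e. e 1 = app f (e 0))" by (intro dfn_intros)
  moreover have "eventually (\<lambda>i. \<exists>x\<in>ext a. x = app f i) uf"
    using f(2) unfolding E_cst by eventually_elim blast
  ultimately obtain k where k: "is_fun k \<delta> a" "eventually (\<lambda>i. app k i = app f i) uf"
    by (rule eventually_choice)
  have "is_fun k \<delta> T"
    using is_fun_app[OF k(1)] transitiveD[OF assms(1,2)] by (intro is_fun_mono[OF k(1)]) auto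
  with k show ?thesis using cl_eqI[OF _ f(1) k(2)] f(3) by (intro that[of k]) auto
qed

text \<open>Arguing with representing functions avoids writing the notion as a formula for
  \<open>Los_Delta0\<close>; the same is done for ordinals.\<close>

lemma transitive_cl:
  assumes T: "transitive T" and f: "is_fun f \<delta> T" and ev: "eventually (\<lambda>i. transitive (app f i)) uf"
  shows "transitive (cl T f)"
  unfolding transitive_def
proof (intro ballI subsetI)
  fix y z assume "y \<in> ext (cl T f)" "z \<in> ext y"
  then obtain g where g: "is_fun g \<delta> T" "E g f" "y = cl T g" using cl_memE[OF f] by blast
  with \<open>z \<in> ext y\<close> obtain h where h: "is_fun h \<delta> T" "E h g" "z = cl T h"
    using cl_memE[OF g(1)] by blast
  have "E h f"
    using ev g(2) h(2) unfolding E_def by eventually_elim (auto simp: transitive_def)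
  then show "z \<in> ext (cl T f)" using cl_mem_iff[OF T h(1) f] h(3) by simp
qed

lemma ordinal_cl:
  assumes T: "transitive T" and f: "is_fun f \<delta> T" and ev: "eventually (\<lambda>i. ordinal (app f i)) uf"
  shows "ordinal (cl T f)"
  unfolding ordinal_iff
proof (intro conjI ballI)
  show "transitive (cl T f)"
    using eventually_mono[OF ev ordinal_transitive] by (rule transitive_cl[OF T f])
  fix y z assume "y \<in> ext (cl T f)" "z \<in> ext (cl T f)"
  then obtain g h where g: "is_fun g \<delta> T" "E g f" "y = cl T g"
    and h: "is_fun h \<delta> T" "E h f" "z = cl T h" using cl_memE[OF f] by metis
  have "eventually (\<lambda>i. app g i \<in> ext (app h i) \<or> (app g i = app h i \<or> app h i \<in> ext (app g i))) uf"
    using ev g(2) h(2) unfolding E_def by eventually_elim (simp add: ordinal_iff)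
  then have "eventually (\<lambda>i. app g i \<in> ext (app h i)) uf \<or>
      eventually (\<lambda>i. app g i = app h i \<or> app h i \<in> ext (app g i)) uf"
    by (rule eventually_or[rotated]) (intro dfn_intros)
  moreover have "eventually (\<lambda>i. app g i = app h i) uf \<or> eventually (\<lambda>i. app h i \<in> ext (app g i)) uf"
    if "eventually (\<lambda>i. app g i = app h i \<or> app h i \<in> ext (app g i)) uf"
    using that by (rule eventually_or[rotated]) (intro dfn_intros)
  ultimately show "y \<in> ext z \<or> y = z \<or> z \<in> ext y"
    using g h cl_mem_iff[OF T g(1) h(1)] cl_mem_iff[OF T h(1) g(1)] cl_eq_iff[OF T g(1) h(1)]
    by (auto simp: E_def)
qed

lemma ordinal_j:
  assumes "transitive T" "\<alpha> \<in> ext T" "ordinal \<alpha>"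
  shows "ordinal (j T \<alpha>)"
  unfolding j_def using assms
  by (intro ordinal_cl is_fun_cst eventually_domI) (simp_all add: app_cst)

text \<open>A least ordinal \<alpha> with \<open>j T \<alpha>\<close> below \<alpha> cannot exist,
  for \<open>j T \<alpha>\<close> would be a smaller one.\<close>

lemma ordinal_subset_j:
  assumes T: "transitive T" and "\<alpha> \<in> ext T" "ordinal \<alpha>"
  shows "ext \<alpha> \<subseteq> ext (j T \<alpha>)"
proof -
  have "ordinal \<alpha> \<longrightarrow> j T \<alpha> \<notin> ext \<alpha>"
    using assms(2)
  proof (induction rule: wf_on_set_induct[where R = "\<lambda>x y. x \<in> ext y"])
    case wf
    show ?case by (rule wf_mem)
  next
    case dfn
    show ?case by (intro dfn_intros)
  next
    case (step \<alpha>)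
    show ?case
    proof (intro impI notI)
      assume a: "ordinal \<alpha>" "j T \<alpha> \<in> ext \<alpha>"
      then have "j T \<alpha> \<in> ext T" "ordinal (j T \<alpha>)"
        using transitiveD[OF T step(1)] ordinal_mem by auto
      then show False using step a j_mem_iff[OF T] by blast
    qed
  qed
  then show ?thesis using ordinal_not_mem assms ordinal_j by blast
qed

lemma ordinal_closed: "ordinal \<alpha> \<Longrightarrow> \<beta> \<in> ext \<alpha> \<Longrightarrow> ext \<beta> \<subseteq> ext \<alpha>"
  using ordinal_transitive by (auto simp: transitive_def)

subsection \<open>Fixed cardinals\<close>

text \<open>Elements of \<open>j T \<alpha>\<close> are represented by functions from \<delta> to
  \<alpha>, and there are fewer than \<nu> of these.\<close>

lemma j_below_inaccessible:
  assumes T: "transitive T" "\<nu> \<in> ext T" and \<nu>: "inaccessible_for \<delta> \<nu>" and \<alpha>: "\<alpha> \<in> ext \<nu>"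
  shows "j T \<alpha> \<in> ext \<nu>"
proof -
  have c\<nu>: "cardinal \<nu>" and o\<nu>: "ordinal \<nu>" using \<nu> by (auto simp: inaccessible_for_def cardinal_def)
  have o\<alpha>: "ordinal \<alpha>" using o\<nu> \<alpha> by (rule ordinal_mem)
  have \<alpha>T: "\<alpha> \<in> ext T" using transitiveD[OF T \<alpha>] .
  obtain l where l: "cardinal l" "equipotent l \<alpha>" "l = \<alpha> \<or> l \<in> ext \<alpha>" using ex_cardinal[OF o\<alpha>] .
  then have "l \<in> ext \<nu>" using \<alpha> ordinal_closed[OF o\<nu> \<alpha>] by blast
  with \<nu> l(1) obtain \<mu> where \<mu>: "is_cardinal_power \<mu> l \<delta>" "\<mu> \<in> ext \<nu>"
    unfolding inaccessible_for_def ext_iff by blast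
  then obtain F where F: "ext F = {f. is_fun f \<delta> l}" "equipotent \<mu> F"
    unfolding is_cardinal_power_def using equipotent_sym by blast
  then obtain b where b: "bij_betw (app b) (ext \<mu>) (ext F)"
    unfolding equipotent_def is_bij_iff by blast
  obtain c where c: "bij_betw (app c) (ext l) (ext \<alpha>)"
    using l(2) unfolding equipotent_def is_bij_iff by blast
  \<comment> \<open>Via \<open>b\<close> the ordinal \<xi> codes a function from \<delta> to the
    cardinality \<open>l\<close> of \<alpha>, and \<open>c\<close> carries its values to \<alpha>;
    so every element of \<open>j T \<alpha>\<close> is some \<open>G \<xi>\<close> with \<xi> in
    \<mu>.\<close>
  define G where "G \<xi> = cl T (lam \<delta> (\<lambda>i. app c (app (app b \<xi>) i)))" for \<xi>
  have tG: "tm (\<lambda>e. G (e 0))" unfolding G_def by (intro dfn_intros)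
  have "ext (j T \<alpha>) \<subseteq> G ` ext \<mu>"
  proof
    fix x assume "x \<in> ext (j T \<alpha>)"
    then obtain k where k: "is_fun k \<delta> \<alpha>" "is_fun k \<delta> T" "x = cl T k" using j_memE[OF T(1) \<alpha>T] by blast
    have "\<exists>y\<in>ext l. app c y = app k i" if "i \<in> ext \<delta>" for i
      using is_fun_app[OF k(1) that] c unfolding bij_betw_def by (metis imageE)
    moreover have "dfn (\<lambda>e. app c (e 1) = app k (e 0))" by (intro dfn_intros)
    ultimately obtain h where h: "is_fun h \<delta> l" "\<And>i. i \<in> ext \<delta> \<Longrightarrow> app c (app h i) = app k i"
      using choice_fun[of "\<lambda>i y. app c y = app k i" \<delta> l] by blast
    then obtain \<xi> where \<xi>: "\<xi> \<in> ext \<mu>" "app b \<xi> = h"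
      using b F(1) unfolding bij_betw_def by (metis imageE mem_Collect_eq)
    have t: "tm (\<lambda>e. app c (app h (e 0)))" by (intro dfn_intros)
    have "is_fun (lam \<delta> (\<lambda>i. app c (app h i))) \<delta> T"
      using h(2) is_fun_app[OF k(2)] by (intro is_fun_lam t) simp
    then have "G \<xi> = cl T k"
      unfolding G_def \<xi>(2) using h(2) t by (intro cl_eqI k(2) eventually_domI) (simp_all add: app_lam)
    then show "x \<in> G ` ext \<mu>" using \<xi>(1) k(3) by (intro image_eqI[of _ _ \<xi>]) simp_all
  qed
  then have n: "\<not> ext \<nu> \<subseteq> ext (j T \<alpha>)"
    using cardinal_no_surj[OF c\<nu> \<mu>(2) tG] by blast
  moreover have oj: "ordinal (j T \<alpha>)" using T(1) \<alpha>T o\<alpha> by (rule ordinal_j)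
  ultimately show ?thesis
    using ordinal_linear[OF o\<nu> oj] ordinal_closed[OF oj] by blast
qed

text \<open>A function from \<delta> to \<nu> is at most some \<alpha> < \<nu> almost everywhere.
  Its collapse is then at most \<open>j T \<alpha>\<close>, which lies below \<nu>.\<close>

lemma j_inaccessible:
  assumes T: "transitive T" "\<nu> \<in> ext T" and \<nu>: "inaccessible_for \<delta> \<nu>" and cof: "\<not> is_cof \<delta> \<nu>"
  shows "j T \<nu> = \<nu>"
proof (rule Extensionality)
  have o\<nu>: "ordinal \<nu>" and o\<delta>: "ordinal \<delta>" using \<nu> by (auto simp: inaccessible_for_def cardinal_def)
  have "ext (j T \<nu>) \<subseteq> ext \<nu>"
  proof
    fix x assume "x \<in> ext (j T \<nu>)"
    then obtain f where f: "is_fun f \<delta> \<nu>" "is_fun f \<delta> T" "x = cl T f" using j_memE[OF T] by blast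
    have "\<exists>\<alpha>\<in>ext \<nu>. eventually (\<lambda>i. app f i \<in> ext \<alpha> \<or> app f i = \<alpha>) uf"
    proof (cases "\<exists>\<beta>\<in>ext \<delta>. \<exists>g. cofinal_map g \<beta> \<nu>")
      case True
      then obtain \<beta> g where \<beta>: "\<beta> \<in> ext \<delta>" and g: "cofinal_map g \<beta> \<nu>" by blast
      have gf: "is_fun g \<beta> \<nu>" using g by (simp add: cofinal_map_def)
      show ?thesis
      proof (rule ccontr)
        \<comment> \<open>If no bound works, \<open>f\<close> exceeds each
          \<open>app g \<xi>\<close> almost everywhere, and completeness gives one coordinate where
          it exceeds all values of the cofinal map.\<close>
        assume n: "\<not> ?thesis"
        define Q where "Q \<xi> i \<longleftrightarrow> \<not> (app f i \<in> ext (app g \<xi>) \<or> app f i = app g \<xi>)" for \<xi> i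
        have "dfn (\<lambda>e. Q (e 0) (e 1))" unfolding Q_def by (intro dfn_intros)
        moreover have "eventually (Q \<xi>) uf" if "\<xi> \<in> ext \<beta>" for \<xi>
        proof -
          have "dfn (\<lambda>e. app f (e 0) \<in> ext (app g \<xi>) \<or> app f (e 0) = app g \<xi>)" by (intro dfn_intros)
          from eventually_not[OF this] show ?thesis
            using n is_fun_app[OF gf that] unfolding Q_def by blast
        qed
        ultimately have "eventually (\<lambda>i. \<forall>\<xi>\<in>ext \<beta>. Q \<xi> i) uf" by (rule eventually_family[OF _ \<beta>])
        then obtain i where i: "i \<in> ext \<delta>" "\<And>\<xi>. \<xi> \<in> ext \<beta> \<Longrightarrow> Q \<xi> i" using eventually_uf_ex by blast
        obtain \<xi> \<gamma> where "\<xi> \<in> ext \<beta>" "rel g \<xi> \<gamma>" "ord_le (app f i) \<gamma>"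
          using g is_fun_app[OF f(1) i(1)] unfolding cofinal_map_def by blast
        then show False using i(2)[of \<xi>] is_fun_rel[OF gf] by (auto simp: Q_def ord_le_def ext_iff)
      qed
    next
      case False
      \<comment> \<open>No ordinal below \<delta> maps cofinally into \<nu>, so a cofinal map on
        \<delta> would make the cofinality \<delta>. Hence \<open>f\<close> is bounded at all
        coordinates.\<close>
      then have "\<not> cofinal_map f \<delta> \<nu>" using cof o\<delta> unfolding is_cof_def by blast
      then obtain \<alpha> where \<alpha>: "\<alpha> \<in> ext \<nu>" "\<And>\<xi> \<beta>. \<xi> \<in> ext \<delta> \<Longrightarrow> rel f \<xi> \<beta> \<Longrightarrow> \<not> ord_le \<alpha> \<beta>"
        unfolding cofinal_map_def using f(1) by blast
      have "app f i \<in> ext \<alpha>" if i: "i \<in> ext \<delta>" for i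
      proof -
        have "\<not> ord_le \<alpha> (app f i)" using \<alpha>(2)[OF i] is_fun_rel[OF f(1)] i by blast
        then show ?thesis
          using ordinal_linear[OF ordinal_mem[OF o\<nu> \<alpha>(1)] ordinal_mem[OF o\<nu> is_fun_app[OF f(1) i]]]
          by (auto simp: ord_le_def ext_iff)
      qed
      then show ?thesis using \<alpha>(1) by (intro bexI[of _ \<alpha>] eventually_domI) auto
    qed
    then obtain \<alpha> where \<alpha>: "\<alpha> \<in> ext \<nu>"
      and ev: "eventually (\<lambda>i. app f i \<in> ext \<alpha> \<or> app f i = \<alpha>) uf" by blast
    have "\<alpha> \<in> ext T" using transitiveD[OF T \<alpha>] .
    moreover have "eventually (\<lambda>i. app f i \<in> ext \<alpha>) uf \<or> eventually (\<lambda>i. app f i = \<alpha>) uf"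
      by (rule eventually_or[OF _ ev]) (intro dfn_intros)
    ultimately have "x \<in> ext (j T \<alpha>) \<or> x = j T \<alpha>"
      using cl_mem_j[OF T(1) f(2)] cl_eq_j[OF T(1) f(2)] f(3) by blast
    then show "x \<in> ext \<nu>"
      using j_below_inaccessible[OF T \<nu> \<alpha>] ordinal_closed[OF o\<nu>] by blast
  qed
  then show "ext (j T \<nu>) = ext \<nu>" using ordinal_subset_j[OF T o\<nu>] by blast
qed

text \<open>If some \<open>x\<close> in \<open>j T \<kappa>\<close> were outside \<kappa>, it would
  contain \<kappa>, and an injection of \<open>x\<close> into \<nu> would restrict to one of the
  cardinal \<kappa> into its element \<nu>.\<close>

lemma j_above_fixed:
  assumes T: "transitive T" "\<kappa> \<in> ext T" and \<kappa>: "cardinal \<kappa>" "\<nu> \<in> ext \<kappa>" "\<delta> \<in> ext \<kappa>" and j\<nu>: "j T \<nu> = \<nu>"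
    and inj: "\<And>\<alpha>. \<alpha> \<in> ext \<kappa> \<Longrightarrow> \<exists>b. is_fun b \<alpha> \<nu> \<and> inj_on (app b) (ext \<alpha>)"
  shows "j T \<kappa> = \<kappa>"
proof (rule Extensionality)
  have o\<kappa>: "ordinal \<kappa>" using \<kappa> by (simp add: cardinal_def)
  have \<nu>T: "\<nu> \<in> ext T" and \<delta>T: "\<delta> \<in> ext T" using transitiveD[OF T] \<kappa> by auto
  have "ext (j T \<kappa>) \<subseteq> ext \<kappa>"
  proof
    fix x assume "x \<in> ext (j T \<kappa>)"
    then obtain f where f: "is_fun f \<delta> \<kappa>" "is_fun f \<delta> T" "x = cl T f" using j_memE[OF T] by blast
    have ox: "ordinal x" unfolding f(3)
      using ordinal_mem[OF o\<kappa> is_fun_app[OF f(1)]] by (intro ordinal_cl T f eventually_domI)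
    \<comment> \<open>Injections of the ordinals \<open>f i\<close> into \<open>\<nu>\<close> represent one of \<open>x\<close> into \<open>j \<nu> = \<nu>\<close>.\<close>
    define R where "R i b \<longleftrightarrow> is_fun b (app f i) \<nu> \<and>
      (\<forall>y\<in>ext (app f i). \<forall>z\<in>ext (app f i). app b y = app b z \<longrightarrow> y = z)" for i b
    have "\<exists>b\<in>ext (pow (prod \<kappa> \<nu>)). R i b" if "i \<in> ext \<delta>" for i
    proof -
      have m: "app f i \<in> ext \<kappa>" using is_fun_app[OF f(1) that] .
      then obtain b where b: "is_fun b (app f i) \<nu>" "inj_on (app b) (ext (app f i))"
        using inj by blast
      have "ext b \<subseteq> ext (prod (app f i) \<nu>)" using b(1) by (simp only: is_fun_def relation_on_iff)
      also have "\<dots> \<subseteq> ext (prod \<kappa> \<nu>)" using ordinal_closed[OF o\<kappa> m] by auto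
      finally have "ext b \<subseteq> ext (prod \<kappa> \<nu>)" .
      moreover have "R i b" using b unfolding R_def inj_on_def by blast
      ultimately show ?thesis by auto
    qed
    moreover have "dfn (\<lambda>e. R (e 0) (e 1))" unfolding R_def by (intro dfn_intros)
    ultimately obtain b where b: "\<And>i. i \<in> ext \<delta> \<Longrightarrow> R i (app b i)"
      using choice_fun[of R \<delta> "pow (prod \<kappa> \<nu>)"] by blast
    define v where "v g i = (if app g i \<in> ext (app f i) then app (app b i) (app g i) else \<delta>)" for g i
    define V where "V g = lam \<delta> (v g)" for g
    have tv: "tm (\<lambda>e. v g (e 0))" for g unfolding v_def by (intro dfn_intros)
    have tV: "tm t \<Longrightarrow> tm (\<lambda>e. V (t e))" for t
      by (rule tm_subst1[where f = V]) (auto simp: V_def v_def intro!: dfn_intros)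
    have v\<nu>: "v g i \<in> ext \<nu>" if "i \<in> ext \<delta>" "app g i \<in> ext (app f i)" for g i
      using b[OF that(1)] that(2) is_fun_app by (auto simp: R_def v_def)
    have VT: "is_fun (V g) \<delta> T" for g
      unfolding V_def
    proof (intro is_fun_lam tv)
      show "v g i \<in> ext T" if "i \<in> ext \<delta>" for i
      proof (cases "app g i \<in> ext (app f i)")
        case True
        then show ?thesis using v\<nu>[OF that] transitiveD[OF T(1) \<nu>T] by blast
      qed (simp add: v_def \<delta>T)
    qed
    have appV: "app (V g) i = v g i" if "i \<in> ext \<delta>" for g i
      unfolding V_def by (intro app_lam tv that)
    have V_eq: "cl T (V g) = cl T (V h) \<longleftrightarrow> cl T g = cl T h"
      if "is_fun g \<delta> T" "is_fun h \<delta> T" "E g f" "E h f" for g h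
    proof -
      have "eventually (\<lambda>i. app (V g) i = app (V h) i \<longleftrightarrow> app g i = app h i) uf"
        using eventually_dom that(3,4)[unfolded E_def]
      proof eventually_elim
        case (elim i)
        then have "app (app b i) (app g i) = app (app b i) (app h i) \<longleftrightarrow> app g i = app h i"
          using b[OF elim(1)] unfolding R_def by metis
        with elim show ?case by (simp add: appV v_def)
      qed
      from eventually_subst[OF this] show ?thesis
        using cl_eq_iff[OF T(1)] VT that by simp
    qed
    have V\<nu>: "cl T (V g) \<in> ext \<nu>" if "E g f" for g
    proof -
      have "eventually (\<lambda>i. app (V g) i \<in> ext \<nu>) uf"
        using eventually_dom that[unfolded E_def] by eventually_elim (simp add: appV v\<nu>)
      then show ?thesis using cl_mem_j[OF T(1) VT \<nu>T] j\<nu> by simp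
    qed
    \<comment> \<open>The passage from \<open>g\<close> to \<open>V g\<close> transferred to
      collapses; \<open>V_eq\<close> makes it well defined and injective.\<close>
    define G where "G y = mk {u. \<exists>g. is_fun g \<delta> T \<and> E g f \<and> cl T g = y \<and> u \<in> ext (cl T (V g))}" for y
    have G: "G (cl T g) = cl T (V g)" if "is_fun g \<delta> T" "E g f" for g
    proof -
      have "{u. \<exists>h. is_fun h \<delta> T \<and> E h f \<and> cl T h = cl T g \<and> u \<in> ext (cl T (V h))} = ext (cl T (V g))"
      proof (intro Set.set_eqI iffI)
        fix u assume "u \<in> {u. \<exists>h. is_fun h \<delta> T \<and> E h f \<and> cl T h = cl T g \<and> u \<in> ext (cl T (V h))}"
        then obtain h where h: "is_fun h \<delta> T" "E h f" "cl T h = cl T g" "u \<in> ext (cl T (V h))" by blast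
        then show "u \<in> ext (cl T (V g))" using V_eq[OF h(1) that(1) h(2) that(2)] by simp
      qed (use that in blast)
      then show ?thesis by (simp add: G_def)
    qed
    have tG: "tm (\<lambda>e. G (e 0))" unfolding G_def by (intro tm_mk dfn_intros tV)
    have "\<not> ext \<kappa> \<subseteq> ext x"
    proof
      assume "ext \<kappa> \<subseteq> ext x"
      then have rep: "\<exists>g. is_fun g \<delta> T \<and> E g f \<and> y = cl T g" if "y \<in> ext \<kappa>" for y
        using that cl_memE[OF f(2)] f(3) by blast
      show False
      proof (rule cardinal_no_inj[OF \<kappa>(1,2) tG])
        show "G ` ext \<kappa> \<subseteq> ext \<nu>" using rep G V\<nu> by fastforce
        show "inj_on G (ext \<kappa>)"
        proof (rule inj_onI)
          fix y z assume yz: "y \<in> ext \<kappa>" "z \<in> ext \<kappa>" "G y = G z"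
          obtain g h where "is_fun g \<delta> T" "E g f" "y = cl T g" "is_fun h \<delta> T" "E h f" "z = cl T h"
            using rep[OF yz(1)] rep[OF yz(2)] by blast
          then show "y = z" using yz(3) G V_eq by simp
        qed
      qed
    qed
    then show "x \<in> ext \<kappa>" using ordinal_linear[OF o\<kappa> ox] ordinal_closed[OF ox] by blast
  qed
  then show "ext (j T \<kappa>) = ext \<kappa>" using ordinal_subset_j[OF T o\<kappa>] by blast
qed

subsection \<open>The image of the embedding\<close>

text \<open>
  Such an \<open>F\<close> would represent the pointwise image of \<open>\<kappa>\<close>.  Choose elements \<open>h i \<in> F i\<close> greedily
  without repetition.  If this succeeds on a measure one set, the choices represent an element
  of the image and are constant almost everywhere, although injective; otherwise \<open>h\<close> enumerates all of \<open>\<kappa>\<close>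
  in \<open>\<delta>\<close> steps.
\<close>

lemma j_image_not_represented:
  assumes T: "transitive T" "\<kappa> \<in> ext T" and \<kappa>: "cardinal \<kappa>" "\<delta> \<in> ext \<kappa>"
    and F: "\<And>g. is_fun g \<delta> \<kappa> \<Longrightarrow> E g F \<longleftrightarrow> cl T g \<in> j T ` ext \<kappa>"
  shows False
proof -
  have o\<kappa>: "ordinal \<kappa>" and o\<delta>: "ordinal \<delta>" using \<kappa> ordinal_mem by (auto simp: cardinal_def)
  \<comment> \<open>\<open>p\<close> will be the restriction of \<open>h\<close> to earlier
    coordinates, so its second components are the values already used.\<close>
  define H where "H i p = least (mk {x. x \<in> ext \<kappa> \<and> x \<in> ext (app F i) \<and> \<not> (\<exists>y. pair y x \<in> ext p)})" for i p
  have tH: "tm (\<lambda>e. H (e 0) (e 1))" unfolding H_def by (intro dfn_intros tm_mk)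
  have R: "dfn (\<lambda>e. e 0 \<in> ext (e 1))" by (intro dfn_intros)
  obtain h where h: "\<And>i. i \<in> ext \<delta> \<Longrightarrow> \<exists>p. app h i = H i p \<and>
      ext p = {q. \<exists>y\<in>ext \<delta>. y \<in> ext i \<and> q = pair y (app h y)}"
    by (rule wf_recursion[OF wf_mem R tH, of \<delta>], rule that) blast
  define A where "A i = mk {x. x \<in> ext \<kappa> \<and> x \<in> ext (app F i) \<and> \<not> (\<exists>y\<in>ext i. x = app h y)}" for i
  have A: "ext (A i) = {x. x \<in> ext \<kappa> \<and> x \<in> ext (app F i) \<and> \<not> (\<exists>y\<in>ext i. x = app h y)}" for i
    unfolding A_def by (intro ext_mk small_Collect[where a = \<kappa>] dfn_intros) auto
  have hA: "app h i = least (A i)" if i: "i \<in> ext \<delta>" for i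
  proof -
    obtain p where p: "app h i = H i p" "ext p = {q. \<exists>y\<in>ext \<delta>. y \<in> ext i \<and> q = pair y (app h y)}"
      using h[OF i] by blast
    have "(\<exists>y. pair y x \<in> ext p) \<longleftrightarrow> (\<exists>y\<in>ext i. x = app h y)" for x
      using p(2) ordinal_closed[OF o\<delta> i] by auto
    then show ?thesis unfolding p(1) H_def A_def by simp
  qed
  have h_mem: "app h i \<in> ext (A i)" if "i \<in> ext \<delta>" "ext (A i) \<noteq> {}" for i
    unfolding hA[OF that(1)] using that(2) ordinal_mem[OF o\<kappa>] by (intro least(1)) (auto simp: A)
  have tA: "tm t \<Longrightarrow> tm (\<lambda>e. A (t e))" for t
    by (rule tm_subst1[where f = A]) (auto simp: A_def intro!: tm_mk dfn_intros)
  have "dfn (\<lambda>e. ext (A (e 0)) = {})" by (intro dfn_intros tA)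
  note * = eventually_not[OF this]
  show False
  proof (cases "eventually (\<lambda>i. ext (A i) = {}) uf")
    case True
    have "ext \<kappa> \<subseteq> app h ` ext \<delta>"
    proof
      fix a assume a: "a \<in> ext \<kappa>"
      \<comment> \<open>\<open>j T a\<close> is in the image, so \<open>a\<close> is in
        \<open>app F i\<close> almost everywhere; where \<open>A i\<close> is empty as well,
        \<open>a\<close> must be an earlier value of \<open>h\<close>.\<close>
      then have "E (cst a) F" using F[OF is_fun_cst[OF a]] by (auto simp: j_def)
      then have "eventually (\<lambda>i. i \<in> ext \<delta> \<and> a \<in> ext (app F i) \<and> ext (A i) = {}) uf"
        using True eventually_dom unfolding E_def by eventually_elim (simp add: app_cst)
      then obtain i where "i \<in> ext \<delta>" "a \<in> ext (app F i)" "ext (A i) = {}"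
        using eventually_uf_ex by blast
      then show "a \<in> app h ` ext \<delta>" using a ordinal_closed[OF o\<delta>] unfolding A by blast
    qed
    moreover have "tm (\<lambda>e. app h (e 0))" by (intro dfn_intros)
    ultimately show False using cardinal_no_surj[OF \<kappa>] by blast
  next
    case False
    then have ev: "eventually (\<lambda>i. ext (A i) \<noteq> {}) uf" using * by simp
    \<comment> \<open>The default \<delta> belongs to \<kappa>, so \<open>g\<close> becomes a
      function into \<kappa>; it is used on a null set only.\<close>
    define v where "v i = (if ext (A i) = {} then \<delta> else app h i)" for i
    have tv: "tm (\<lambda>e. v (e 0))" unfolding v_def by (intro dfn_intros tA)
    define g where "g = lam \<delta> v"
    have g: "is_fun g \<delta> \<kappa>"
      unfolding g_def
    proof (rule is_fun_lam[OF tv])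
      show "v i \<in> ext \<kappa>" if "i \<in> ext \<delta>" for i
        using h_mem[OF that] \<kappa>(2) by (auto simp: v_def A)
    qed
    have appg: "app g i = v i" if "i \<in> ext \<delta>" for i unfolding g_def by (rule app_lam[OF tv that])
    have gT: "is_fun g \<delta> T"
      using transitiveD[OF T] is_fun_app[OF g] by (intro is_fun_mono[OF g]) auto
    have "E g F"
      unfolding E_def using ev eventually_dom
      by eventually_elim (use h_mem in \<open>auto simp: appg v_def A\<close>)
    then obtain a where a: "a \<in> ext \<kappa>" "cl T g = j T a" using F[OF g] by blast
    have "eventually (\<lambda>i. app g i = a) uf"
      using cl_eq_j[OF T(1) gT transitiveD[OF T a(1)]] a(2) by simp
    with ev eventually_dom
    have ev': "eventually (\<lambda>i. i \<in> ext \<delta> \<and> ext (A i) \<noteq> {} \<and> app h i = a) uf"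
      by eventually_elim (simp add: appg v_def)
    then obtain i where i: "i \<in> ext \<delta>" "ext (A i) \<noteq> {}" "app h i = a" using eventually_uf_ex by blast
    \<comment> \<open>Elements of \<open>A l\<close> avoid all earlier values, so among coordinates
      with nonempty \<open>A\<close> the value \<open>a\<close> is taken only once.\<close>
    have nolt: "k \<notin> ext l" if "ext (A l) \<noteq> {}" "l \<in> ext \<delta>" "app h k = a" "app h l = a" for k l
      using h_mem[OF that(2,1)] that(3,4) by (auto simp: A)
    have "eventually (\<lambda>k. k = i) uf"
      using ev'
    proof eventually_elim
      case (elim k)
      then show ?case
        using nolt[of k i] nolt[of i k] i ordinal_linear[of i k] ordinal_mem[OF o\<delta>] by blast
    qed
    then show False using not_eventually_eq by blast
  qed
qed

subsection \<open>Good wellorderings\<close>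

text \<open>
  The transitive set has to contain the witnesses for \<open>\<phi>\<close>, hence depends on \<open>e\<close>; by \<open>cl_extend\<close>,
  enlarging it does not change the embedding on \<open>T0\<close>.
\<close>

lemma Sigma1_upward:
  assumes "Sigma1 \<phi>" "sat e \<phi>" "finite (range e)"
  shows "\<exists>T. transitive T \<and> ext T0 \<subseteq> ext T \<and> sat (\<lambda>n. j T (e n)) \<phi>"
  using assms
proof (induction arbitrary: e)
  case (1 \<phi>)
  \<comment> \<open>Finitely many values form a set of the model, which can be put inside
    \<open>T\<close>.\<close>
  have r: "ext (mk (range e)) = range e" using 1 by (intro ext_mk small_finite)
  obtain T where T: "transitive T" "ext (un T0 (mk (range e))) \<subseteq> ext T"
    using transitive_closure[OF omega(1)] .
  then have sub: "ext T0 \<subseteq> ext T" "range e \<subseteq> ext T" by (simp_all add: r)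
  have "is_fun (cst (e n)) \<delta> T" for n using sub(2) by (intro is_fun_cst) auto
  then have "sat (\<lambda>n. j T (e n)) \<phi> \<longleftrightarrow> eventually (\<lambda>i. sat (\<lambda>n. app (cst (e n)) i) \<phi>) uf"
    unfolding j_def by (rule Los_Delta0[OF T(1) 1(1)])
  moreover have "eventually (\<lambda>i. sat (\<lambda>n. app (cst (e n)) i) \<phi>) uf"
    using 1(2) by (intro eventually_domI) (simp add: app_cst)
  ultimately show ?case using T(1) sub by blast
next
  case (2 \<phi> i)
  then obtain x where x: "sat (e(i := x)) \<phi>" by auto
  have "finite (range (e(i := x)))"
    by (rule finite_subset[of _ "insert x (range e)"]) (use 2(4) in auto)
  from 2(2)[OF x this] obtain T where T: "transitive T" "ext T0 \<subseteq> ext T"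
    "sat (\<lambda>n. j T ((e(i := x)) n)) \<phi>" by blast
  have "(\<lambda>n. j T ((e(i := x)) n)) = (\<lambda>n. j T (e n))(i := j T x)" by auto
  then have "sat (\<lambda>n. j T (e n)) (FEx i \<phi>)" using T(3) by auto
  with T(1,2) show ?case by blast
qed

lemma no_good_Sigma1_wellordering:
  assumes \<kappa>: "cardinal \<kappa>" "\<delta> \<in> ext \<kappa>"
    and fixed: "\<And>T. transitive T \<Longrightarrow> \<kappa> \<in> ext T \<Longrightarrow> j T \<kappa> = \<kappa>"
    and P: "is_powerset P \<kappa>" and good: "good_Sigma1_wellordering [\<kappa>] W P"
  shows False
proof -
  have P: "ext P = {s. ext s \<subseteq> ext \<kappa>}" using P by (simp add: is_powerset_def)
  \<comment> \<open>\<kappa>, its subsets and all initial segments have to be elements of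
    \<open>T\<close>. They are subsets of \<open>P\<close>, which is transitive because \<kappa>
    is.\<close>
  define T where "T = pow P"
  have "ext x \<subseteq> ext P" if "x \<in> ext P" for x
    using that ordinal_closed[of \<kappa>] \<kappa>(1) by (auto simp: P cardinal_def)
  then have T: "transitive T" unfolding transitive_def T_def by auto
  have \<kappa>T: "\<kappa> \<in> ext T" using ordinal_closed[of \<kappa>] \<kappa>(1) by (auto simp: T_def P cardinal_def)
  have PT: "x \<in> ext T" if "x \<in> ext P" for x
    by (rule transitiveD[OF T _ that]) (simp add: T_def)
  define lt where "lt = rel W"
  have lt': "tm s \<Longrightarrow> tm t \<Longrightarrow> dfn (\<lambda>e. lt (s e) (t e))" for s t
    unfolding lt_def rel_iff by (intro dfn_intros)
  have wo: "strictly_wellorders lt P" using good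
    by (simp add: good_Sigma1_wellordering_def wellordering_def lt_def)
  note wo = wo[unfolded strictly_wellorders_def]
  have irr: "\<not> lt x x" if "x \<in> ext P" for x using wo that by (elim conjE) blast
  have trans: "lt x z" if "lt x y" "lt y z" "x \<in> ext P" "y \<in> ext P" "z \<in> ext P" for x y z
    using wo that by (elim conjE) blast
  have lin: "lt x y \<or> x = y \<or> lt y x" if "x \<in> ext P" "y \<in> ext P" for x y
    using wo that by (elim conjE) blast
  have min: "\<exists>m\<in>ext s. \<forall>x\<in>ext s. x = m \<or> lt m x" if "ext s \<subseteq> ext P" "ext s \<noteq> {}" for s
    using wo that by (elim conjE) blast

  define seg where "seg x = mk {y. y \<in> ext P \<and> lt y x}" for x
  have seg: "ext (seg x) = {y. y \<in> ext P \<and> lt y x}" for x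
    unfolding seg_def by (intro ext_mk small_Collect[where a = P] dfn_intros lt') auto
  have seg': "tm t \<Longrightarrow> tm (\<lambda>e. seg (t e))" for t
    by (rule tm_subst1[where f = seg]) (auto simp: seg_def intro!: tm_mk dfn_intros lt')
  have segT: "seg x \<in> ext T" for x by (auto simp: T_def seg)
  have I: "initial_segments W P = seg ` ext P"
  proof -
    have "ext s = {x \<in> ext P. rel W x y} \<longleftrightarrow> s = seg y" for s y
      unfolding lt_def[symmetric] ext_inject[symmetric] seg by simp
    then show ?thesis unfolding initial_segments_def by blast
  qed
  have "Sigma1_definable [\<kappa>] (seg ` ext P)"
    using good unfolding good_Sigma1_wellordering_def I by blast
  then obtain \<phi> where \<phi>: "Sigma1 \<phi>" "fv \<phi> \<subseteq> {..1}" "seg ` ext P = {x. sat (\<lambda>i. [x, \<kappa>] ! i) \<phi>}"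
    unfolding Sigma1_definable_def by auto
  \<comment> \<open>Replacing the values beyond the free variables by \<kappa> leaves an assignment
    with finite range, as \<open>Sigma1_upward\<close> requires.\<close>
  have I_iff: "x \<in> seg ` ext P \<longleftrightarrow> sat (\<lambda>i. if i = 0 then x else \<kappa>) \<phi>" for x
  proof -
    have "sat (\<lambda>i. [x, \<kappa>] ! i) \<phi> \<longleftrightarrow> sat (\<lambda>i. if i = 0 then x else \<kappa>) \<phi>"
    proof (rule sat_cong_fv)
      fix i assume "i \<in> fv \<phi>"
      then have "i = 0 \<or> i = 1" using \<phi>(2) by auto
      then show "[x, \<kappa>] ! i = (if i = 0 then x else \<kappa>)" by auto
    qed
    then show ?thesis unfolding \<phi>(3) by simp
  qed
  have "\<exists>y\<in>ext P. j T (seg x) = seg y" if "x \<in> ext P" for x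
  proof -
    define e where "e i = (if i = 0 then seg x else \<kappa>)" for i :: nat
    have "sat e \<phi>" using I_iff[of "seg x"] that by (simp add: e_def[abs_def])
    moreover have "finite (range e)"
      by (rule finite_subset[of _ "{seg x, \<kappa>}"]) (auto simp: e_def)
    ultimately obtain T' where T': "transitive T'" "ext T \<subseteq> ext T'" "sat (\<lambda>n. j T' (e n)) \<phi>"
      using Sigma1_upward[OF \<phi>(1)] by blast
    have "j T' \<kappa> = \<kappa>" using T'(1,2) \<kappa>T by (intro fixed) auto
    moreover have "j T' (seg x) = j T (seg x)"
      unfolding j_def using cl_extend[OF T T'(1,2) is_fun_cst[OF segT]] by simp
    ultimately have "(\<lambda>n. j T' (e n)) = (\<lambda>i. if i = 0 then j T (seg x) else \<kappa>)"
      by (auto simp: e_def)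
    then show ?thesis using T'(3) I_iff[of "j T (seg x)"] by auto
  qed
  then obtain h where h: "\<And>x. x \<in> ext P \<Longrightarrow> h x \<in> ext P"
    "\<And>x. x \<in> ext P \<Longrightarrow> j T (seg x) = seg (h x)" by metis

  \<comment> \<open>Otherwise the segment below \<open>h y\<close> is contained in that below
    \<open>h x\<close>. The former is \<open>j T (seg y)\<close> and contains \<open>j T x\<close>,
    the latter is \<open>j T (seg x)\<close>; so \<open>x\<close> would precede itself.\<close>
  have mono: "lt (h x) (h y)" if xy: "x \<in> ext P" "y \<in> ext P" "lt x y" for x y
  proof (rule ccontr)
    assume "\<not> lt (h x) (h y)"
    then have *: "ext (seg (h y)) \<subseteq> ext (seg (h x))"
      using lin[OF h(1)[OF xy(1)] h(1)[OF xy(2)]] trans[OF _ _ _ h(1)[OF xy(2)] h(1)[OF xy(1)]]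
      by (auto simp: seg)
    have "j T x \<in> ext (j T (seg y))" using j_mem_iff[OF T PT[OF xy(1)] segT] xy by (simp add: seg)
    then have "j T x \<in> ext (j T (seg x))" using * xy h(2) by auto
    then show False using j_mem_iff[OF T PT[OF xy(1)] segT] irr[OF xy(1)] by (simp add: seg)
  qed
  have increasing: "\<not> lt (h x) x" if x: "x \<in> ext P" for x
  proof
    assume "lt (h x) x"
    \<comment> \<open>\<open>h\<close> was chosen outside the model and comes without a definition.
      \<open>B\<close> therefore describes \<open>h x\<close> as the \<open>y\<close> with
      \<open>j T (seg x) = seg y\<close>.\<close>
    define B where "B = mk {x. x \<in> ext P \<and> (\<exists>y\<in>ext P. j T (seg x) = seg y \<and> lt y x)}"
    have "ext B = {x. x \<in> ext P \<and> (\<exists>y\<in>ext P. j T (seg x) = seg y \<and> lt y x)}"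
      unfolding B_def by (intro ext_mk small_Collect[where a = P] dfn_intros lt' seg') auto
    moreover have "y = h x" if "x \<in> ext P" "y \<in> ext P" "j T (seg x) = seg y" for x y
    proof -
      have "ext (seg y) = ext (seg (h x))" using h(2)[OF that(1)] that(3) by simp
      then show ?thesis using lin[OF that(2) h(1)[OF that(1)]] irr that(2) h(1)[OF that(1)]
        unfolding seg by blast
    qed
    ultimately have B: "ext B = {x. x \<in> ext P \<and> lt (h x) x}" using h by blast
    then obtain m where m: "m \<in> ext P" "lt (h m) m" "\<And>x. x \<in> ext P \<Longrightarrow> lt (h x) x \<Longrightarrow> x = m \<or> lt m x"
      using min[of B] x \<open>lt (h x) x\<close> by auto
    have "lt (h (h m)) (h m)" using mono h m by blast
    then have "h m = m \<or> lt m (h m)" using m(3)[OF h(1)[OF m(1)]] by blast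
    then show False using m irr trans[of m "h m" m] h by auto
  qed
  define represented where "represented y \<longleftrightarrow> (\<exists>f. is_fun f \<delta> T \<and> y = cl T f)" for y
  have rep: "represented y" if "x \<in> ext P" "y \<in> ext P" "lt y (h x)" for x y
  proof -
    have "y \<in> ext (j T (seg x))" using that h(2) by (simp add: seg)
    then show ?thesis using j_memE[OF T segT] unfolding represented_def by metis
  qed
  have unique: "a = b" if "a \<in> ext P" "b \<in> ext P" "\<not> represented a" "\<not> represented b" for a b
  proof -
    have "\<not> lt c d" if cd: "c \<in> ext P" "d \<in> ext P" "\<not> represented c" for c d
    proof
      assume "lt c d"
      moreover have "d = h d \<or> lt d (h d)" using lin[OF cd(2) h(1)[OF cd(2)]] increasing[OF cd(2)] by blast
      ultimately have "lt c (h d)"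
      proof (elim disjE)
        assume "lt c d" "lt d (h d)"
        then show ?thesis using cd(1,2) h(1)[OF cd(2)] by (rule trans)
      qed (erule subst, assumption)
      then show False using rep[OF cd(2,1)] cd(3) by blast
    qed
    from this[OF that(1-3)] this[OF that(2,1,4)] lin[OF that(1,2)] show ?thesis by simp
  qed

  have toT: "is_fun g \<delta> T" if "is_fun g \<delta> \<kappa>" for g
    using transitiveD[OF T \<kappa>T] is_fun_app[OF that] by (intro is_fun_mono[OF that]) auto
  have to\<kappa>: "cl T g \<in> ext \<kappa>" if "is_fun g \<delta> \<kappa>" for g
  proof -
    have "eventually (\<lambda>i. app g i \<in> ext \<kappa>) uf" by (intro eventually_domI is_fun_app[OF that])
    then have "cl T g \<in> ext (j T \<kappa>)" using cl_mem_j[OF T toT[OF that] \<kappa>T] by simp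
    then show ?thesis using fixed[OF T \<kappa>T] by simp
  qed
  define z where "z = mk (j T ` ext \<kappa>)"
  have z: "ext z = j T ` ext \<kappa>"
    unfolding z_def by (intro ext_mk small_image dfn_intros)
  have z\<kappa>: "ext z \<subseteq> ext \<kappa>"
    using j_mem_iff[OF T _ \<kappa>T] transitiveD[OF T \<kappa>T] fixed[OF T \<kappa>T] unfolding z by auto
  define z' where "z' = mk {x. x \<in> ext \<kappa> \<and> x \<notin> ext z}"
  have z': "ext z' = {x. x \<in> ext \<kappa> \<and> x \<notin> ext z}"
    unfolding z'_def by (intro ext_mk small_Collect[where a = \<kappa>] dfn_intros) auto
  have "\<not> represented z"
  proof
    assume "represented z"
    then obtain f where f: "is_fun f \<delta> T" "z = cl T f" unfolding represented_def by blast
    show False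
      by (rule j_image_not_represented[OF T \<kappa>T \<kappa>, of f])
        (use cl_mem_iff[OF T toT f(1)] f(2) z in auto)
  qed
  moreover have "\<not> represented z'"
  proof
    assume "represented z'"
    then obtain f where f: "is_fun f \<delta> T" "z' = cl T f" unfolding represented_def by blast
    \<comment> \<open>Complementing the values of \<open>f\<close> in \<kappa> turns a
      representation of \<open>z'\<close> into one of \<open>z\<close>: for functions
      \<open>g\<close> into \<kappa> the collapse stays in \<kappa>, and the measure decides whether
      \<open>app g i\<close> is in \<open>app f i\<close>.\<close>
    define C where "C i = mk {x. x \<in> ext \<kappa> \<and> x \<notin> ext (app f i)}" for i
    have C: "ext (C i) = {x. x \<in> ext \<kappa> \<and> x \<notin> ext (app f i)}" for i
      unfolding C_def by (intro ext_mk small_Collect[where a = \<kappa>] dfn_intros) auto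
    have tC: "tm (\<lambda>e. C (e 0))" unfolding C_def by (intro tm_mk dfn_intros)
    show False
    proof (rule j_image_not_represented[OF T \<kappa>T \<kappa>, of "lam \<delta> C"])
      fix g assume g: "is_fun g \<delta> \<kappa>"
      have "E g (lam \<delta> C) \<longleftrightarrow> eventually (\<lambda>i. app g i \<notin> ext (app f i)) uf"
        unfolding E_def
        by (rule eventually_subst, rule eventually_mono[OF eventually_dom])
          (simp add: app_lam[OF tC] C is_fun_app[OF g])
      also have "\<dots> \<longleftrightarrow> \<not> E g f"
        unfolding E_def by (rule eventually_not) (intro dfn_intros)
      also have "\<dots> \<longleftrightarrow> cl T g \<notin> ext z'"
        using cl_mem_iff[OF T toT[OF g] f(1)] f(2) by simp
      also have "\<dots> \<longleftrightarrow> cl T g \<in> j T ` ext \<kappa>"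
        using to\<kappa>[OF g] z by (simp add: z')
      finally show "E g (lam \<delta> C) \<longleftrightarrow> cl T g \<in> j T ` ext \<kappa>" .
    qed
  qed
  ultimately have "z = z'" using z\<kappa> by (intro unique) (auto simp: P z')
  then have "\<delta> \<in> ext z \<longleftrightarrow> \<delta> \<notin> ext z" using z' \<kappa>(2) by blast
  then show False by simp
qed

end

theorem lemma1p3:
  fixes mem :: "'v \<Rightarrow> 'v \<Rightarrow> bool" and \<delta> \<nu> \<nu>_plus \<kappa> P :: 'v
  assumes "ZFC_structure mem"
    and "set_structure.measurable_cardinal mem \<delta>"
    and "set_structure.inaccessible_for mem \<delta> \<nu>"
    and "\<not> set_structure.is_cof mem \<delta> \<nu>"
    and "set_structure.is_successor_cardinal mem \<nu>_plus \<nu>"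
    and "set_structure.cardinal mem \<kappa>"
    and "set_structure.ord_le mem \<nu> \<kappa>" and "set_structure.ord_le mem \<kappa> \<nu>_plus"
    and "set_structure.is_powerset mem P \<kappa>"
  shows "\<not> (\<exists>w. set_structure.good_Sigma1_wellordering mem [\<kappa>] w P)"
proof -
  interpret ZFC_structure mem by fact
  obtain w U where "is_omega w" "mem w \<delta>" "ultrafilter_on U \<delta>" "nonprincipal U \<delta>" "complete_filter \<delta> U \<delta>"
    using assms(2) unfolding measurable_cardinal_def by blast
  then interpret measure_on mem w \<delta> U
    by unfold_locales (simp_all add: ext_iff)
  have \<nu>: "cardinal \<nu>" "\<delta> \<in> ext \<nu>" using assms(3) by (simp_all add: inaccessible_for_def ext_iff)
  have le: "\<nu> \<in> ext \<kappa> \<or> \<nu> = \<kappa>" using assms(7) by (simp add: ord_le_def ext_iff)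
  have \<delta>\<kappa>: "\<delta> \<in> ext \<kappa>"
    using le \<nu>(2) ordinal_closed[of \<kappa> \<nu>] assms(6) by (auto simp: cardinal_def)
  have o\<kappa>: "ordinal \<kappa>" using assms(6) by (rule cardinal_ordinal)
  have "j T \<kappa> = \<kappa>" if T: "transitive T" "\<kappa> \<in> ext T" for T
  proof (cases "\<nu> = \<kappa>")
    case True
    then show ?thesis using j_inaccessible[OF T] assms(3,4) by simp
  next
    case False
    then have \<nu>\<kappa>: "\<nu> \<in> ext \<kappa>" using le by simp
    have "\<nu> \<in> ext T" using transitiveD[OF T \<nu>\<kappa>] .
    then have "j T \<nu> = \<nu>" using j_inaccessible[OF T(1)] assms(3,4) by simp
    then show ?thesis
    proof (rule j_above_fixed[OF T assms(6) \<nu>\<kappa> \<delta>\<kappa>])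
      fix \<alpha> assume \<alpha>: "\<alpha> \<in> ext \<kappa>"
      have "ordinal \<alpha>" using o\<kappa> \<alpha> by (rule ordinal_mem)
      then obtain l where l: "cardinal l" "equipotent l \<alpha>" "l = \<alpha> \<or> l \<in> ext \<alpha>" using ex_cardinal by blast
      have l\<kappa>: "l \<in> ext \<kappa>" using l(3) \<alpha> ordinal_closed[OF o\<kappa> \<alpha>] by blast
      have o\<nu>: "ordinal \<nu>" and ol: "ordinal l" using \<nu>(1) l(1) by (simp_all add: cardinal_def)
      \<comment> \<open>A cardinal \<open>l\<close> above \<nu> would be at least
        \<open>\<nu>_plus\<close>, although \<open>l\<close> is below \<kappa> and \<kappa> is at
        most \<open>\<nu>_plus\<close>.\<close>
      have "\<nu> \<notin> ext l"
      proof
        assume "\<nu> \<in> ext l"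
        then have "ord_le \<nu>_plus l"
          using assms(5) l(1) unfolding is_successor_cardinal_def ext_iff by blast
        then have "\<nu>_plus \<in> ext l \<or> \<nu>_plus = l" by (simp add: ord_le_def ext_iff)
        moreover have "\<kappa> \<in> ext \<nu>_plus \<or> \<kappa> = \<nu>_plus" using assms(8) by (simp add: ord_le_def ext_iff)
        ultimately show False using l\<kappa> mem_asym mem_irrefl mem_no_3cycle by metis
      qed
      then have sub: "ext l \<subseteq> ext \<nu>" using ordinal_not_mem[OF ol o\<nu>] by blast
      obtain b where b: "is_fun b \<alpha> l" "bij_betw (app b) (ext \<alpha>) (ext l)"
        using equipotent_sym[OF l(2)] unfolding equipotent_def is_bij_iff by blast
      have "is_fun b \<alpha> \<nu>" using sub is_fun_app[OF b(1)] by (intro is_fun_mono[OF b(1)]) auto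
      then show "\<exists>b. is_fun b \<alpha> \<nu> \<and> inj_on (app b) (ext \<alpha>)" using b(2) by (auto simp: bij_betw_def)
    qed
  qed
  then show ?thesis
    using no_good_Sigma1_wellordering[OF assms(6) \<delta>\<kappa> _ assms(9)] by blast
qed

end
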